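(* Let $\mathfrak I\sim\mathcal I(n,D,p)$. Then: (a) $P(\dim S/\mathfrak I=0)=\bigl(1-(1-p)^D\bigr)^n$. (b) $P(\dim S/\mathfrak I=1)=\sum_{j=0}^{n-1}\binom nj\bigl(1-(1-p)^D\bigr)^j(1-p)^{D(n-j)}\Bigl(1-(1-p)^{\binom D2}\Bigr)^{\binom{n-j}{2}}$. (c) $P(\dim S/\mathfrak I=n-1)=-(1-p)^{\binom{n+D}{n}-1}+\sum_{j=1}^{n}(-1)^{j-1}\binom nj(1-p)^{\binom{n+D}{n}-1-\binom{n+D-j}{n}}$. (d) $P(\dim S/\mathfrak I=n)=(1-p)^{\binom{n+D}{n}-1}$. For $n\le4$, the listed formulas give the complete probability distribution of Krull dimension induced by $\mathcal I(n,D,p)$, for any integer $D$.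
   Context: Let $k$ be a field and $S=k[x_1,\dots,x_n]$. Given an integer $D$ and $p\in[0,1]$, let $\mathfrak B$ be the random set of monomials of $S$ obtained by including each non-constant monomial of total degree at most $D$ independently with probability $p$. $\mathcal I(n,D,p)$ is the distribution of the random monomial ideal $\mathfrak I=(\mathfrak B)$, with $\mathfrak I=(0)$ if $\mathfrak B=\emptyset$. $\dim$ denotes Krull dimension. *)

theory Defs
  imports
    "HOL-Probability.Probability"
    "HOL-Algebra.Algebraic_Closure_Type"
    "HOL-Library.Poly_Mapping"
begin

text \<open>Krull dimension is the supremum of the lengths of strict chains of prime ideals. It is taken
  in the extended reals, so that a ring without prime ideals (the zero ring) has dimension
  \<open>-\<infinity>\<close> and is not confused with a ring of dimension 0.\<close>

definition prime_chain :: "('a, 'b) ring_scheme \<Rightarrow> nat \<Rightarrow> (nat \<Rightarrow> 'a set) \<Rightarrow> bool" where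
  "prime_chain R l C \<longleftrightarrow> (\<forall>i\<le>l. primeideal (C i) R) \<and> (\<forall>i<l. C i \<subset> C (Suc i))"

definition krull_dim :: "('a, 'b) ring_scheme \<Rightarrow> ereal" where
  "krull_dim R = (SUP l \<in> {l. \<exists>C. prime_chain R l C}. ereal (real l))"

text \<open>For \<open>'v\<close> finite, \<open>('v, 'k) mpoly\<close> is the polynomial ring over \<open>'k\<close> in the \<open>CARD('v)\<close>
  variables indexed by \<open>'v\<close>: finitely supported coefficient functions on exponent vectors, with
  convolution as product. Since \<open>'v\<close> is a type, \<open>CARD('v)\<close> is at least 1.\<close>

type_synonym ('v, 'k) mpoly = "('v \<Rightarrow>\<^sub>0 nat) \<Rightarrow>\<^sub>0 'k"

abbreviation polynomial_ring :: "('v::finite, 'k::field) mpoly ring" where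
  "polynomial_ring \<equiv> ring_of_type_algebra"

definition total_degree :: "('v::finite \<Rightarrow>\<^sub>0 nat) \<Rightarrow> nat" where
  "total_degree e = (\<Sum>v\<in>UNIV. Poly_Mapping.lookup e v)"

definition nonconst_monomials :: "nat \<Rightarrow> ('v::finite, 'k::field) mpoly set" where
  "nonconst_monomials D =
     {Poly_Mapping.single e 1 | e. 0 < total_degree e \<and> total_degree e \<le> D}"

lemma finite_nonconst_monomials:
  "finite (nonconst_monomials D :: ('v::finite, 'k::field) mpoly set)"
proof -
  have "finite {e :: 'v \<Rightarrow>\<^sub>0 nat. total_degree e \<le> D}"
  proof (rule finite_imageD[of Poly_Mapping.lookup])
    have "Poly_Mapping.lookup e v \<le> total_degree e" for e :: "'v \<Rightarrow>\<^sub>0 nat" and v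
      unfolding total_degree_def by (rule member_le_sum) simp_all
    then have "Poly_Mapping.lookup ` {e :: 'v \<Rightarrow>\<^sub>0 nat. total_degree e \<le> D}
        \<subseteq> (UNIV \<rightarrow>\<^sub>E {..D})"
      by (fastforce intro: order_trans)
    then show "finite (Poly_Mapping.lookup ` {e :: 'v \<Rightarrow>\<^sub>0 nat. total_degree e \<le> D})"
      by (rule finite_subset) (simp add: finite_PiE)
  qed (simp add: inj_on_def)
  moreover have "nonconst_monomials D
      \<subseteq> (\<lambda>e. Poly_Mapping.single e 1) ` {e :: 'v \<Rightarrow>\<^sub>0 nat. total_degree e \<le> D}"
    by (auto simp: nonconst_monomials_def)
  ultimately show ?thesis
    by (blast intro: finite_subset)
qed

text \<open>Every element of the finite set \<open>A\<close> is included independently with probability \<open>p\<close>.\<close>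

definition random_subset :: "'a set \<Rightarrow> real \<Rightarrow> 'a set pmf" where
  "random_subset A p = map_pmf (\<lambda>f. {a \<in> A. f a}) (Pi_pmf A False (\<lambda>_. bernoulli_pmf p))"

text \<open>The number of variables is fixed by the type. The ideal generated by the empty set is the
  zero ideal.\<close>

definition random_monomial_ideal :: "nat \<Rightarrow> real \<Rightarrow> ('v::finite, 'k::field) mpoly set pmf" where
  "random_monomial_ideal D p =
     map_pmf (\<lambda>B. Idl\<^bsub>polynomial_ring\<^esub> B) (random_subset (nonconst_monomials D) p)"

end

theory Submission
  imports Defs
begin

text \<open>The proof reduces Krull dimension to combinatorics and then computes with independent events.

  Let \<open>B\<close> be a set of non-constant monomials with ideal \<open>I\<close>. Call a set \<open>W\<close> of variables independent
  if no monomial of \<open>B\<close> involves only variables from \<open>W\<close>. Then \<open>dim S/I\<close> is the largest size of an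
  independent set (\<open>krull_dim_monomial_quotient\<close>). The lower bound comes from the prime ideals generated
  by the variables outside \<open>W\<close>: they contain \<open>I\<close>, and shrinking \<open>W\<close> one variable at a time gives a chain of
  length \<open>card W\<close>. For the upper bound take a chain of primes \<open>C 0 \<subset> \<dots> \<subset> C l\<close> above \<open>I\<close> and let \<open>W\<close> be the
  set of variables outside \<open>C 0\<close>. It is independent because \<open>C 0\<close> is prime. Elements
  \<open>f i \<in> C (Suc i) - C i\<close> are algebraically independent over \<open>k\<close> modulo \<open>C 0\<close>
  (\<open>prime_steps_algebraically_independent\<close>), and modulo \<open>C 0\<close> they may be taken in \<open>k[W]\<close>. But in \<open>k[W]\<close>
  there are too few monomials of bounded degree for more than \<open>card W\<close> polynomials to be algebraically
  independent (\<open>length_prime_steps_le\<close>). So \<open>l \<le> card W\<close>.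

  The event that the dimension is at least \<open>k\<close> is thus the event that \<open>B\<close> avoids all monomials supported
  in some \<open>k\<close>-set of variables. The monomials with support exactly \<open>U\<close> number \<open>D choose card U\<close>, and the
  choices for different \<open>U\<close> are independent. Dimension 0 means that every variable has a power in \<open>B\<close>.
  Dimension 1 means that, with \<open>J\<close> the set of variables having a power in \<open>B\<close>, the complement of \<open>J\<close> is
  non-empty and each pair in it is the support of a monomial in \<open>B\<close>; one sums over \<open>J\<close>. Dimension at
  least \<open>n - 1\<close> means that some variable divides every monomial in \<open>B\<close>, which is inclusion-exclusion over
  sets of variables, and dimension \<open>n\<close> means that \<open>B\<close> is empty. For \<open>n \<le> 4\<close> at most one value of the
  dimension, namely 2 when \<open>n = 4\<close>, is left, and it gets the remaining probability.\<close>

section \<open>Random subsets avoiding and hitting given sets\<close>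

lemma prob_random_subset_avoids:
  assumes "finite A" "T \<subseteq> A" "0 \<le> p" "p \<le> 1"
  shows "measure_pmf.prob (random_subset A p) {B. B \<inter> T = {}} = (1 - p) ^ card T"
proof -
  have "(\<lambda>f. {a \<in> A. f a}) -` {B. B \<inter> T = {}} = Pi A (\<lambda>x. if x \<in> T then {False} else UNIV)"
    using assms(2) by (fastforce simp: Pi_def)
  then have "measure_pmf.prob (random_subset A p) {B. B \<inter> T = {}} =
      (\<Prod>x\<in>A. measure_pmf.prob (bernoulli_pmf p) (if x \<in> T then {False} else UNIV))"
    unfolding random_subset_def by (simp add: measure_map_pmf measure_Pi_pmf_Pi assms(1))
  also have "\<dots> = (\<Prod>x\<in>A. if x \<in> T then 1 - p else 1)"
    using assms(3,4) by (intro prod.cong) (auto simp: measure_pmf_single)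
  also have "\<dots> = (1 - p) ^ card T"
    using assms(1,2) by (simp add: prod.If_cases Int_absorb1)
  finally show ?thesis .
qed

text \<open>Hitting a set is the complement of avoiding it. This recurrence trades a hitting condition for an
  avoiding one, so that both product formula and inclusion-exclusion follow by induction from the
  avoidance probability alone.\<close>

lemma prob_hits_insert:
  "measure_pmf.prob M {B. B \<inter> R = {} \<and> (\<forall>i\<in>insert j J. B \<inter> T i \<noteq> {})} =
   measure_pmf.prob M {B. B \<inter> R = {} \<and> (\<forall>i\<in>J. B \<inter> T i \<noteq> {})} -
   measure_pmf.prob M {B. B \<inter> (R \<union> T j) = {} \<and> (\<forall>i\<in>J. B \<inter> T i \<noteq> {})}"
  by (subst measure_pmf.finite_measure_Diff [symmetric]) (auto intro!: arg_cong [where f = "measure_pmf.prob M"])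

lemma prob_random_subset_avoids_hits_disjoint:
  assumes "finite A" "0 \<le> p" "p \<le> 1"
    and "finite J" "disjoint_family_on T J" "R \<subseteq> A" "\<And>i. i \<in> J \<Longrightarrow> T i \<subseteq> A"
    and "\<And>i. i \<in> J \<Longrightarrow> R \<inter> T i = {}"
  shows "measure_pmf.prob (random_subset A p) {B. B \<inter> R = {} \<and> (\<forall>i\<in>J. B \<inter> T i \<noteq> {})} =
    (1 - p) ^ card R * (\<Prod>i\<in>J. 1 - (1 - p) ^ card (T i))"
  using assms(4-)
proof (induction J arbitrary: R rule: finite_induct)
  case empty
  then show ?case
    using prob_random_subset_avoids [OF assms(1) _ assms(2,3)] by simp
next
  case (insert j J)
  have J: "disjoint_family_on T J" and dj: "\<And>i. i \<in> J \<Longrightarrow> T j \<inter> T i = {}"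
    using insert.prems(1) insert.hyps(2) by (auto simp: disjoint_family_on_def)
  have fin: "finite R" "finite (T j)"
    using insert.prems assms(1) by (auto intro: finite_subset)
  have "card (R \<union> T j) = card R + card (T j)"
    using insert.prems(4)[of j] fin by (simp add: card_Un_disjoint)
  moreover have "measure_pmf.prob (random_subset A p)
      {B. B \<inter> (R \<union> T j) = {} \<and> (\<forall>i\<in>J. B \<inter> T i \<noteq> {})} =
      (1 - p) ^ card (R \<union> T j) * (\<Prod>i\<in>J. 1 - (1 - p) ^ card (T i))"
    using insert.prems dj J by (intro insert.IH) (simp_all add: Int_Un_distrib2)
  moreover have "measure_pmf.prob (random_subset A p)
      {B. B \<inter> R = {} \<and> (\<forall>i\<in>J. B \<inter> T i \<noteq> {})} =
      (1 - p) ^ card R * (\<Prod>i\<in>J. 1 - (1 - p) ^ card (T i))"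
    using insert.prems J by (intro insert.IH) simp_all
  ultimately show ?case
    using insert.hyps by (simp only: prob_hits_insert)
      (simp add: power_add algebra_simps)
qed

lemma sum_Pow_insert:
  assumes "finite J" "j \<notin> J"
  shows "(\<Sum>K\<in>Pow (insert j J). f K) = (\<Sum>K\<in>Pow J. f K) + (\<Sum>K\<in>Pow J. f (insert j K))"
proof -
  have "inj_on (insert j) (Pow J)"
    using assms(2) by (auto simp: inj_on_def)
  then show ?thesis
    using assms unfolding Pow_insert
    by (subst sum.union_disjoint) (auto simp: sum.reindex)
qed

lemma prob_random_subset_avoids_hits:
  assumes "finite A" "0 \<le> p" "p \<le> 1"
    and "finite J" "R \<subseteq> A" "\<And>i. i \<in> J \<Longrightarrow> T i \<subseteq> A"
  shows "measure_pmf.prob (random_subset A p) {B. B \<inter> R = {} \<and> (\<forall>i\<in>J. B \<inter> T i \<noteq> {})} =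
    (\<Sum>K\<in>Pow J. (-1) ^ card K * (1 - p) ^ card (R \<union> (\<Union>i\<in>K. T i)))"
  using assms(4-)
proof (induction J arbitrary: R rule: finite_induct)
  case empty
  then show ?case
    using prob_random_subset_avoids [OF assms(1) _ assms(2,3)] by simp
next
  case (insert j J)
  have "(\<Sum>K\<in>Pow J. (-1) ^ card (insert j K) * (1 - p) ^ card (R \<union> (\<Union>i\<in>insert j K. T i))) =
      - (\<Sum>K\<in>Pow J. (-1) ^ card K * (1 - p) ^ card ((R \<union> T j) \<union> (\<Union>i\<in>K. T i)))"
    unfolding sum_negf [symmetric]
  proof (intro sum.cong refl)
    fix K assume "K \<in> Pow J"
    then have "card (insert j K) = Suc (card K)"
      using insert.hyps finite_subset by (subst card_insert_disjoint) auto
    then show "(-1) ^ card (insert j K) * (1 - p) ^ card (R \<union> (\<Union>i\<in>insert j K. T i)) =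
      - ((-1) ^ card K * (1 - p) ^ card ((R \<union> T j) \<union> (\<Union>i\<in>K. T i)))"
      by (simp add: Un_assoc)
  qed
  moreover have "measure_pmf.prob (random_subset A p)
      {B. B \<inter> (R \<union> T j) = {} \<and> (\<forall>i\<in>J. B \<inter> T i \<noteq> {})} =
      (\<Sum>K\<in>Pow J. (-1) ^ card K * (1 - p) ^ card ((R \<union> T j) \<union> (\<Union>i\<in>K. T i)))"
    using insert.prems by (intro insert.IH) auto
  moreover have "measure_pmf.prob (random_subset A p)
      {B. B \<inter> R = {} \<and> (\<forall>i\<in>J. B \<inter> T i \<noteq> {})} =
      (\<Sum>K\<in>Pow J. (-1) ^ card K * (1 - p) ^ card (R \<union> (\<Union>i\<in>K. T i)))"
    using insert.prems by (intro insert.IH) auto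
  ultimately show ?case
    by (simp only: prob_hits_insert sum_Pow_insert [OF insert.hyps])
qed

text \<open>Turns the sums over sets of variables into sums over \<open>j\<close> weighted by binomial coefficients.\<close>

lemma sum_subsets_by_card:
  fixes g :: "nat \<Rightarrow> 'b::comm_semiring_1"
  assumes "finite J"
  shows "(\<Sum>K\<in>{K. K \<subseteq> J \<and> card K \<in> I}. g (card K)) = (\<Sum>j\<in>I \<inter> {..card J}. of_nat (card J choose j) * g j)"
proof -
  have "(\<Sum>K\<in>{K. K \<subseteq> J \<and> card K \<in> I}. g (card K)) =
      (\<Sum>j\<in>I \<inter> {..card J}. \<Sum>K\<in>{K\<in>{K. K \<subseteq> J \<and> card K \<in> I}. card K = j}. g (card K))"
    using assms by (intro sum.group [symmetric]) (auto intro: card_mono)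
  also have "\<dots> = (\<Sum>j\<in>I \<inter> {..card J}. of_nat (card J choose j) * g j)"
  proof (intro sum.cong refl)
    fix j assume "j \<in> I \<inter> {..card J}"
    then have "{K\<in>{K. K \<subseteq> J \<and> card K \<in> I}. card K = j} = {K. K \<subseteq> J \<and> card K = j}"
      by auto
    then show "(\<Sum>K\<in>{K\<in>{K. K \<subseteq> J \<and> card K \<in> I}. card K = j}. g (card K)) =
        of_nat (card J choose j) * g j"
      using n_subsets [OF assms, of j] by simp
  qed
  finally show ?thesis .
qed

section \<open>Counting exponent vectors\<close>

text \<open>The monomials with support between \<open>J\<close> and \<open>V\<close> and bounded degree. All counts below are instances:
  \<open>J = {}\<close> for the monomials in the variables \<open>V\<close>, \<open>V = UNIV\<close> for the multiples of the product of \<open>J\<close>, and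
  \<open>J = V\<close> for the monomials with support exactly \<open>V\<close>.\<close>

definition exponents :: "'v::finite set \<Rightarrow> 'v set \<Rightarrow> nat \<Rightarrow> ('v \<Rightarrow>\<^sub>0 nat) set" where
  "exponents V J D = {e. Poly_Mapping.keys e \<subseteq> V \<and> J \<subseteq> Poly_Mapping.keys e \<and> total_degree e \<le> D}"

lemma inj_monomial: "inj (\<lambda>e :: 'e. Poly_Mapping.single e (1 :: 'k::field))"
proof (rule injI)
  fix e e' :: 'e
  assume "Poly_Mapping.single e (1 :: 'k) = Poly_Mapping.single e' 1"
  from arg_cong [OF this, of Poly_Mapping.keys] show "e = e'"
    by simp
qed

lemma total_degree_add: "total_degree (e + f) = total_degree e + total_degree f"
  by (simp add: total_degree_def lookup_add sum.distrib)

lemma total_degree_single: "total_degree (Poly_Mapping.single v m) = m"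
  by (simp add: total_degree_def lookup_single when_def)

lemma total_degree_0_iff: "total_degree e = 0 \<longleftrightarrow> e = 0"
  by (auto simp: total_degree_def intro: poly_mapping_eqI)

lemma keys_add_nat: "Poly_Mapping.keys (e + f) = Poly_Mapping.keys e \<union> Poly_Mapping.keys f"
  for e f :: "'v \<Rightarrow>\<^sub>0 nat"
  by (auto simp: in_keys_iff lookup_add)

lemma finite_exponents: "finite (exponents V J D)"
  for V :: "'v::finite set"
proof -
  \<comment> \<open>The rationals serve as a coefficient field, to transfer finiteness from monomials to exponents.\<close>
  have "finite ((\<lambda>e :: 'v \<Rightarrow>\<^sub>0 nat. Poly_Mapping.single e (1 :: rat)) -` nonconst_monomials D)"
    by (rule finite_vimageI [OF finite_nonconst_monomials inj_monomial])
  moreover have "exponents V J D \<subseteq> insert 0 ((\<lambda>e. Poly_Mapping.single e (1 :: rat)) -` nonconst_monomials D)"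
    using total_degree_0_iff by (fastforce simp: exponents_def nonconst_monomials_def)
  ultimately show ?thesis
    by (meson finite.insertI finite_subset)
qed

lemma exponent_split:
  assumes "v \<in> Poly_Mapping.keys e"
  obtains e' where "e = Poly_Mapping.single v (1::nat) + e'"
proof
  show "e = Poly_Mapping.single v 1 + (e - Poly_Mapping.single v 1)"
    using assms by (intro poly_mapping_eqI) (auto simp: lookup_add lookup_minus lookup_single when_def in_keys_iff)
qed

lemma exponents_insert_Suc:
  assumes "v \<in> V" "v \<notin> J"
  shows "exponents V (insert v J) (Suc D) = (\<lambda>e. Poly_Mapping.single v 1 + e) ` exponents V J D"
    (is "?L = ?R")
proof
  show "?R \<subseteq> ?L"
    using assms by (auto simp: exponents_def keys_add_nat total_degree_add total_degree_single)
  show "?L \<subseteq> ?R"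
  proof
    fix e assume e: "e \<in> ?L"
    then have "v \<in> Poly_Mapping.keys e"
      by (simp add: exponents_def)
    then obtain e' where e': "e = Poly_Mapping.single v 1 + e'"
      by (rule exponent_split)
    then have "e' \<in> exponents V J D"
      using e assms by (auto simp: exponents_def keys_add_nat total_degree_add total_degree_single)
    then show "e \<in> ?R"
      using e' by blast
  qed
qed

lemma card_exponents_insert_Suc:
  assumes "v \<in> V" "v \<notin> J"
  shows "card (exponents V (insert v J) (Suc D)) = card (exponents V J D)"
  unfolding exponents_insert_Suc [OF assms] by (simp add: card_image)

text \<open>Pascal's rule: a monomial of degree at most \<open>D + 1\<close> either does not involve \<open>v\<close>, or is \<open>v\<close> times a
  monomial of degree at most \<open>D\<close>.\<close>

lemma card_exponents_no_lower: "card (exponents V {} D) = (D + card V) choose card V"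
  for V :: "'v::finite set"
proof (induction V arbitrary: D rule: finite_induct [OF finite])
  case 1
  have "exponents {} {} D = {0 :: 'v \<Rightarrow>\<^sub>0 nat}"
    by (auto simp: exponents_def total_degree_def)
  then show ?case
    by simp
next
  case (2 v V)
  show ?case
  proof (induction D)
    case 0
    have "exponents (insert v V) {} 0 = {0 :: 'v \<Rightarrow>\<^sub>0 nat}"
      by (auto simp: exponents_def total_degree_0_iff)
    then show ?case
      by simp
  next
    case (Suc D)
    have "exponents (insert v V) {} (Suc D) =
        exponents V {} (Suc D) \<union> exponents (insert v V) {v} (Suc D)"
      by (auto simp: exponents_def)
    moreover have "exponents V {} (Suc D) \<inter> exponents (insert v V) {v} (Suc D) = {}"
      using 2(2) by (auto simp: exponents_def)
    ultimately have "card (exponents (insert v V) {} (Suc D)) =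
        card (exponents V {} (Suc D)) + card (exponents (insert v V) {} D)"
      by (simp add: card_Un_disjoint finite_exponents card_exponents_insert_Suc)
    also have "\<dots> = (Suc D + Suc (card V)) choose Suc (card V)"
      using Suc 2 by (simp add: add.commute)
    finally show ?case
      using 2(2) by simp
  qed
qed

text \<open>Dividing by the product of \<open>J\<close> removes the lower bound on the support and lowers the degree bound by
  \<open>card J\<close>. For \<open>D < card J\<close> both sides vanish.\<close>

lemma card_exponents:
  fixes V :: "'v::finite set"
  assumes "J \<subseteq> V"
  shows "card (exponents V J D) = (D + card V - card J) choose card V"
  using finite [of J] assms
proof (induction J arbitrary: D rule: finite_induct)
  case empty
  show ?case
    using card_exponents_no_lower [of V D] by simp
next
  case (insert v J)
  show ?case
  proof (cases D)
    case 0
    have "exponents V (insert v J) 0 = {}"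
      by (auto simp: exponents_def total_degree_0_iff)
    moreover have "card V > 0"
      using insert.prems by (simp add: card_gt_0_iff) auto
    ultimately show ?thesis
      using 0 insert.hyps by (simp add: binomial_eq_0)
  next
    case (Suc D')
    then show ?thesis
      using insert.IH [of D'] insert.hyps insert.prems by (simp add: card_exponents_insert_Suc)
  qed
qed

section \<open>Prime ideals in rings given by a type class, and in quotient rings\<close>

lemma carrier_type_algebra [simp]: "carrier ring_of_type_algebra = UNIV"
  and mult_type_algebra [simp]: "x \<otimes>\<^bsub>ring_of_type_algebra\<^esub> y = x * y"
  and add_type_algebra [simp]: "x \<oplus>\<^bsub>ring_of_type_algebra\<^esub> y = x + y"
  and zero_type_algebra [simp]: "\<zero>\<^bsub>ring_of_type_algebra\<^esub> = 0"
  and one_type_algebra [simp]: "\<one>\<^bsub>ring_of_type_algebra\<^esub> = 1"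
  by (simp_all add: ring_of_type_algebra_def)

text \<open>A record-free form of primality for rings given by a type class, in which the carrier is the whole
  type.\<close>

locale prime_ideal =
  fixes P :: "'a::comm_ring_1 set"
  assumes zero: "0 \<in> P"
    and add: "a \<in> P \<Longrightarrow> b \<in> P \<Longrightarrow> a + b \<in> P"
    and mult: "a \<in> P \<Longrightarrow> x * a \<in> P"
    and one: "1 \<notin> P"
    and prime: "a * b \<in> P \<Longrightarrow> a \<in> P \<or> b \<in> P"
begin

lemma mult_right: "a \<in> P \<Longrightarrow> a * x \<in> P"
  using mult [of a x] by (simp add: mult.commute)

lemma diff: "a \<in> P \<Longrightarrow> b \<in> P \<Longrightarrow> a - b \<in> P"
  using add [of a "- b"] mult [of b "- 1"] by simp

lemma sum: "(\<And>x. x \<in> A \<Longrightarrow> f x \<in> P) \<Longrightarrow> (\<Sum>x\<in>A. f x) \<in> P"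
  by (induction A rule: infinite_finite_induct) (auto simp: zero add)

lemma power: "a ^ n \<in> P \<Longrightarrow> a \<in> P"
  by (induction n) (use one prime in auto)

end

lemma primeideal_type_algebra_iff:
  "primeideal P (ring_of_type_algebra :: 'a::comm_ring_1 ring) \<longleftrightarrow> prime_ideal P"
    (is "primeideal P ?R \<longleftrightarrow> _")
proof
  assume "primeideal P ?R"
  then interpret P: primeideal P ?R .
  show "prime_ideal P"
  proof
    show "0 \<in> P"
      using additive_subgroup.zero_closed [OF P.is_additive_subgroup] by simp
    show "a + b \<in> P" if "a \<in> P" "b \<in> P" for a b
      using additive_subgroup.a_closed [OF P.is_additive_subgroup that] by simp
    show "x * a \<in> P" if "a \<in> P" for a x
      using P.I_l_closed [OF that, of x] by simp
    show "1 \<notin> P"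
      using P.one_imp_carrier P.I_notcarr by auto
    show "a \<in> P \<or> b \<in> P" if "a * b \<in> P" for a b
      using P.I_prime [of a b] that by simp
  qed
next
  assume "prime_ideal P"
  then interpret prime_ideal P .
  have R: "cring ?R" "ring ?R"
    by (rule cring_from_type_algebra ring_from_type_algebra)+
  interpret R: ring ?R by (fact R)
  show "primeideal P ?R"
  proof (rule primeidealI)
    show "ideal P ?R"
    proof (rule idealI [OF R(2)])
      show "subgroup P (add_monoid ?R)"
      proof (rule R.add.subgroupI)
        show "\<ominus>\<^bsub>?R\<^esub> a \<in> P" if "a \<in> P" for a
        proof -
          have "\<ominus>\<^bsub>?R\<^esub> a = - a"
            using R.minus_equality [of "- a" a] by simp
          then show ?thesis
            using diff [OF zero that] by simp
        qed
      qed (use zero add in auto)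
    qed (use mult mult_right in auto)
    show "carrier ?R \<noteq> P"
      using one by auto
    show "a \<in> P \<or> b \<in> P" if "a \<otimes>\<^bsub>?R\<^esub> b \<in> P" for a b
      using prime that by simp
  qed (fact R)
qed

text \<open>Preimages of primes of the quotient are primes containing \<open>I\<close>. Conversely, a prime containing \<open>I\<close> is
  a union of cosets, so its image determines it, is prime, and strict inclusions stay strict.\<close>

lemma prime_chain_quot_iff:
  assumes R: "cring R" and I: "ideal I R"
  shows "(\<exists>C. prime_chain (R Quot I) l C) \<longleftrightarrow> (\<exists>C. prime_chain R l C \<and> (\<forall>i\<le>l. I \<subseteq> C i))"
proof
  have zero_quot: "\<zero>\<^bsub>R Quot I\<^esub> = I"
    unfolding FactRing_def by simp
  interpret R: cring R by (fact R)
  interpret I: ideal I R by (fact I)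
  interpret h: ring_hom_ring R "R Quot I" "(+>\<^bsub>R\<^esub>) I"
    by (rule I.rcos_ring_hom_ring)
  let ?h = "(+>\<^bsub>R\<^esub>) I"
  have surj: "\<exists>r\<in>carrier R. x = ?h r" if "x \<in> carrier (R Quot I)" for x
    using that unfolding FactRing_def A_RCOSETS_def' by simp
  {
    assume "\<exists>C. prime_chain (R Quot I) l C"
    then obtain C where C: "\<And>i. i \<le> l \<Longrightarrow> primeideal (C i) (R Quot I)"
      and less: "\<And>i. i < l \<Longrightarrow> C i \<subset> C (Suc i)"
      unfolding prime_chain_def by blast
    have sub: "C i \<subseteq> carrier (R Quot I)" if "i \<le> l" for i
      by (rule additive_subgroup.a_subset [OF ideal.axioms(1) [OF primeideal.axioms(1) [OF C [OF that]]]])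
    let ?C = "\<lambda>i. {r \<in> carrier R. ?h r \<in> C i}"
    have "?C i \<subset> ?C (Suc i)" if i: "i < l" for i
    proof -
      obtain x where x: "x \<in> C (Suc i)" "x \<notin> C i"
        using less [OF i] by blast
      moreover have "x \<in> carrier (R Quot I)"
        using x(1) sub [of "Suc i"] i by auto
      ultimately show ?thesis
        using less [OF i] surj [of x] by blast
    qed
    moreover have "primeideal (?C i) R" if "i \<le> l" for i
      using h.primeideal_vimage [OF R C [OF that]] .
    moreover have "I \<subseteq> ?C i" if "i \<le> l" for i
    proof
      fix x assume x: "x \<in> I"
      have "\<zero>\<^bsub>R Quot I\<^esub> \<in> C i"
        by (rule additive_subgroup.zero_closed [OF ideal.axioms(1) [OF primeideal.axioms(1) [OF C [OF that]]]])
      then have "?h x \<in> C i"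
        using zero_quot I.a_rcos_const [OF x] by metis
      then show "x \<in> ?C i"
        using I.a_subset x by blast
    qed
    ultimately have "prime_chain R l ?C \<and> (\<forall>i\<le>l. I \<subseteq> ?C i)"
      unfolding prime_chain_def by blast
    then show "\<exists>C. prime_chain R l C \<and> (\<forall>i\<le>l. I \<subseteq> C i)"
      by (intro exI [of _ ?C])
  next
    assume "\<exists>C. prime_chain R l C \<and> (\<forall>i\<le>l. I \<subseteq> C i)"
    then obtain C where C: "\<And>i. i \<le> l \<Longrightarrow> primeideal (C i) R"
      and less: "\<And>i. i < l \<Longrightarrow> C i \<subset> C (Suc i)" and sub: "\<And>i. i \<le> l \<Longrightarrow> I \<subseteq> C i"
      unfolding prime_chain_def by blast
    have carr: "C i \<subseteq> carrier R" if "i \<le> l" for i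
      by (rule additive_subgroup.a_subset [OF ideal.axioms(1) [OF primeideal.axioms(1) [OF C [OF that]]]])
    have mem: "?h r \<in> ?h ` C i \<longleftrightarrow> r \<in> C i" if r: "r \<in> carrier R" and i: "i \<le> l" for r i
    proof
      assume "?h r \<in> ?h ` C i"
      then obtain s where s: "s \<in> C i" "?h r = ?h s"
        by blast
      then have "s \<in> carrier R" "r \<in> ?h s"
        using carr [OF i] I.a_rcos_self [OF r] by auto
      then obtain x where "x \<in> I" "r = x \<oplus>\<^bsub>R\<^esub> s"
        unfolding a_r_coset_def' by blast
      then show "r \<in> C i"
        using additive_subgroup.a_closed [OF ideal.axioms(1) [OF primeideal.axioms(1) [OF C [OF i]]]]
          sub [OF i] s(1) by blast
    qed simp
    have "primeideal (?h ` C i) (R Quot I)" if i: "i \<le> l" for i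
    proof (rule primeidealI)
      interpret P: primeideal "C i" R by (rule C [OF i])
      show "ideal (?h ` C i) (R Quot I)"
        by (rule R.ring_ideal_imp_quot_ideal [OF I P.is_ideal])
      show "cring (R Quot I)"
        by (rule I.quotient_is_cring [OF R])
      show "carrier (R Quot I) \<noteq> ?h ` C i"
      proof
        assume "carrier (R Quot I) = ?h ` C i"
        then have "?h \<one>\<^bsub>R\<^esub> \<in> ?h ` C i"
          using h.hom_closed [OF R.one_closed] by blast
        then show False
          using mem [OF R.one_closed i] P.one_imp_carrier P.I_notcarr by blast
      qed
      fix a b
      assume a: "a \<in> carrier (R Quot I)" and b: "b \<in> carrier (R Quot I)"
        and ab: "a \<otimes>\<^bsub>R Quot I\<^esub> b \<in> ?h ` C i"
      obtain r s where rs: "r \<in> carrier R" "a = ?h r" "s \<in> carrier R" "b = ?h s"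
        using surj a b by blast
      then have "?h (r \<otimes>\<^bsub>R\<^esub> s) \<in> ?h ` C i"
        using ab rs h.hom_mult by metis
      then have "r \<in> C i \<or> s \<in> C i"
        using mem [OF R.m_closed [OF rs(1,3)] i] rs(1,3) P.I_prime by blast
      then show "a \<in> ?h ` C i \<or> b \<in> ?h ` C i"
        using rs by auto
    qed
    moreover have "?h ` C i \<subset> ?h ` C (Suc i)" if i: "i < l" for i
    proof -
      obtain x where x: "x \<in> C (Suc i)" "x \<notin> C i"
        using less [OF i] by blast
      then have "?h x \<notin> ?h ` C i"
        using mem [of x i] carr [of "Suc i"] i by auto
      then show ?thesis
        using x less [OF i] by blast
    qed
    ultimately show "\<exists>C. prime_chain (R Quot I) l C"
      unfolding prime_chain_def by (intro exI [of _ "\<lambda>i. ?h ` C i"]) simp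
  }
qed

section \<open>Prime ideals generated by variables\<close>

text \<open>Restrict both sets to the maximal coordinate of one variable after another: the elements that remain have
  this property. Their sum plays the part of the leading exponent of a product in the proof that coordinate
  ideals are prime.\<close>

lemma exists_unique_exponent_sum:
  fixes A B :: "('v::finite \<Rightarrow>\<^sub>0 nat) set"
  assumes "finite A" "A \<noteq> {}" "finite B" "B \<noteq> {}"
  shows "\<exists>a\<in>A. \<exists>b\<in>B. \<forall>x\<in>A. \<forall>y\<in>B. x + y = a + b \<longrightarrow> x = a \<and> y = b"
proof -
  have "\<exists>a\<in>A. \<exists>b\<in>B. \<forall>x\<in>A. \<forall>y\<in>B. x + y = a + b \<longrightarrow>
      (\<forall>v\<in>V. Poly_Mapping.lookup x v = Poly_Mapping.lookup a v \<and> Poly_Mapping.lookup y v = Poly_Mapping.lookup b v)"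
    if "finite V" for V :: "'v set"
    using that assms
  proof (induction V arbitrary: A B rule: finite_induct)
    case empty
    then show ?case by blast
  next
    case (insert v V)
    \<comment> \<open>Keep only the elements whose \<open>v\<close>-coordinate is maximal: a sum of two maximal coordinates forces both summands to be maximal.\<close>
    let ?top = "\<lambda>C :: ('v \<Rightarrow>\<^sub>0 nat) set. Max ((\<lambda>x. Poly_Mapping.lookup x v) ` C)"
    define A' where "A' = {x \<in> A. Poly_Mapping.lookup x v = ?top A}"
    define B' where "B' = {x \<in> B. Poly_Mapping.lookup x v = ?top B}"
    have "?top A \<in> (\<lambda>x. Poly_Mapping.lookup x v) ` A" "?top B \<in> (\<lambda>x. Poly_Mapping.lookup x v) ` B"
      using insert.prems by (auto intro!: Max_in simp del: Max_in)
    then have "A' \<noteq> {}" "B' \<noteq> {}"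
      unfolding A'_def B'_def by (smt (verit) empty_iff imageE mem_Collect_eq)+
    moreover have "finite A'" "finite B'"
      using insert.prems by (auto simp: A'_def B'_def)
    ultimately obtain a b where ab: "a \<in> A'" "b \<in> B'"
      and uniq: "\<And>x y. x \<in> A' \<Longrightarrow> y \<in> B' \<Longrightarrow> x + y = a + b \<Longrightarrow>
        \<forall>v\<in>V. Poly_Mapping.lookup x v = Poly_Mapping.lookup a v \<and> Poly_Mapping.lookup y v = Poly_Mapping.lookup b v"
      using insert.IH [of A' B'] by blast
    have "\<forall>w\<in>insert v V. Poly_Mapping.lookup x w = Poly_Mapping.lookup a w \<and> Poly_Mapping.lookup y w = Poly_Mapping.lookup b w"
      if x: "x \<in> A" and y: "y \<in> B" and xy: "x + y = a + b" for x y
    proof -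
      have "Poly_Mapping.lookup x v \<le> ?top A" "Poly_Mapping.lookup y v \<le> ?top B"
        using x y insert.prems by auto
      moreover have "Poly_Mapping.lookup a v = ?top A" "Poly_Mapping.lookup b v = ?top B"
        using ab by (simp_all add: A'_def B'_def)
      moreover have "Poly_Mapping.lookup x v + Poly_Mapping.lookup y v = Poly_Mapping.lookup a v + Poly_Mapping.lookup b v"
        using xy by (metis lookup_add)
      ultimately have v: "Poly_Mapping.lookup x v = ?top A" "Poly_Mapping.lookup y v = ?top B"
        by linarith+
      then have "x \<in> A'" "y \<in> B'"
        using x y by (simp_all add: A'_def B'_def)
      then show ?thesis
        using uniq [OF _ _ xy] v ab by (simp add: A'_def B'_def)
    qed
    moreover have "a \<in> A" "b \<in> B"
      using ab by (simp_all add: A'_def B'_def)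
    ultimately show ?case
      by blast
  qed
  from this [of UNIV] show ?thesis
    by (metis finite iso_tuple_UNIV_I poly_mapping_eqI)
qed

lemma lookup_mult_unique:
  fixes f g :: "('v::finite \<Rightarrow>\<^sub>0 nat) \<Rightarrow>\<^sub>0 'k::field"
  assumes "\<And>x y. x \<in> Poly_Mapping.keys f \<Longrightarrow> y \<in> Poly_Mapping.keys g \<Longrightarrow> x + y = a + b \<Longrightarrow> x = a \<and> y = b"
  shows "Poly_Mapping.lookup (f * g) (a + b) = Poly_Mapping.lookup f a * Poly_Mapping.lookup g b"
proof -
  have "Poly_Mapping.lookup (f * g) (a + b) =
      Sum_any (\<lambda>l. Poly_Mapping.lookup f l * Sum_any (\<lambda>q. Poly_Mapping.lookup g q when a + b = l + q))"
    by (rule lookup_mult)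
  also have "\<dots> = Sum_any (\<lambda>l. Poly_Mapping.lookup f a * Poly_Mapping.lookup g b when l = a)"
  proof (intro Sum_any.cong)
    fix l
    show "Poly_Mapping.lookup f l * Sum_any (\<lambda>q. Poly_Mapping.lookup g q when a + b = l + q) =
        (Poly_Mapping.lookup f a * Poly_Mapping.lookup g b when l = a)"
    proof (cases "l = a \<or> Poly_Mapping.lookup f l = 0")
      case True
      then show ?thesis by (auto simp: when_def)
    next
      case False
      then have "(Poly_Mapping.lookup g q when a + b = l + q) = 0" for q
        using assms [of l q] by (cases "Poly_Mapping.lookup g q = 0") (auto simp: in_keys_iff when_def)
      then show ?thesis
        using False by simp
    qed
  qed
  finally show ?thesis by simp
qed

text \<open>The ideal generated by the variables outside \<open>W\<close>, that is, the kernel of the map that sets them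
  to 0.\<close>

definition coordinate_ideal :: "'v::finite set \<Rightarrow> ('v, 'k::field) mpoly set" where
  "coordinate_ideal W = {f. \<forall>e\<in>Poly_Mapping.keys f. \<not> Poly_Mapping.keys e \<subseteq> W}"

text \<open>If neither factor lies in the ideal, choose among their terms supported in \<open>W\<close> two whose product is not
  cancelled. Only such terms can contribute, since the support of a factor lies in that of the product.\<close>

lemma prime_coordinate_ideal: "prime_ideal (coordinate_ideal W :: ('v::finite, 'k::field) mpoly set)"
proof
  fix f g :: "('v, 'k) mpoly"
  show "f + g \<in> coordinate_ideal W" if "f \<in> coordinate_ideal W" "g \<in> coordinate_ideal W"
    using that keys_add [of f g] by (auto simp: coordinate_ideal_def)
  show "g * f \<in> coordinate_ideal W" if "f \<in> coordinate_ideal W"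
    using that keys_mult [of g f] by (fastforce simp: coordinate_ideal_def keys_add_nat)
  show "f \<in> coordinate_ideal W \<or> g \<in> coordinate_ideal W" if fg: "f * g \<in> coordinate_ideal W"
  proof (rule ccontr)
    assume neg: "\<not> ?thesis"
    let ?A = "{e \<in> Poly_Mapping.keys f. Poly_Mapping.keys e \<subseteq> W}"
    let ?B = "{e \<in> Poly_Mapping.keys g. Poly_Mapping.keys e \<subseteq> W}"
    have "?A \<noteq> {}" "?B \<noteq> {}"
      using neg by (auto simp: coordinate_ideal_def)
    then obtain a b where ab: "a \<in> ?A" "b \<in> ?B"
      and uniq: "\<And>x y. x \<in> ?A \<Longrightarrow> y \<in> ?B \<Longrightarrow> x + y = a + b \<Longrightarrow> x = a \<and> y = b"
      using exists_unique_exponent_sum [of ?A ?B] by auto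
    have W: "Poly_Mapping.keys (a + b) \<subseteq> W"
      using ab by (simp add: keys_add_nat)
    have "x = a \<and> y = b"
      if x: "x \<in> Poly_Mapping.keys f" and y: "y \<in> Poly_Mapping.keys g" and xy: "x + y = a + b" for x y
    proof -
      have "Poly_Mapping.keys x \<union> Poly_Mapping.keys y \<subseteq> W"
        using W by (simp add: keys_add_nat flip: xy)
      then show ?thesis
        using x y xy by (intro uniq) auto
    qed
    then have "Poly_Mapping.lookup (f * g) (a + b) = Poly_Mapping.lookup f a * Poly_Mapping.lookup g b"
      by (rule lookup_mult_unique)
    then have "a + b \<in> Poly_Mapping.keys (f * g)"
      using ab by (simp add: in_keys_iff)
    then show False
      using fg W by (auto simp: coordinate_ideal_def)
  qed
qed (auto simp: coordinate_ideal_def)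

section \<open>Algebraic independence along chains of prime ideals\<close>

text \<open>Elimination of one unknown by one equation.\<close>

lemma homogeneous_system_nontrivial_solution:
  fixes M :: "'b \<Rightarrow> 'a \<Rightarrow> 'k::field"
  assumes "finite B" "finite A" "card B < card A"
  shows "\<exists>c. (\<exists>a\<in>A. c a \<noteq> 0) \<and> (\<forall>b\<in>B. (\<Sum>a\<in>A. M b a * c a) = 0)"
  using assms
proof (induction B arbitrary: A M rule: finite_induct)
  case empty
  then have "A \<noteq> {}"
    by auto
  then show ?case
    by (intro exI [of _ "\<lambda>_. 1"]) auto
next
  case (insert b B)
  show ?case
  proof (cases "\<forall>a\<in>A. M b a = 0")
    case True
    have "card B < card A"
      using insert by simp
    then obtain c where "\<exists>a\<in>A. c a \<noteq> 0" "\<forall>b\<in>B. (\<Sum>a\<in>A. M b a * c a) = 0"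
      using insert.IH [of A M] insert.prems by blast
    then show ?thesis
      using True by (intro exI [of _ c]) auto
  next
    case False
    then obtain a0 where a0: "a0 \<in> A" "M b a0 \<noteq> 0"
      by blast
    let ?A = "A - {a0}"
    have "card B < card ?A"
      using insert a0 by simp
    then obtain c where c: "\<exists>a\<in>?A. c a \<noteq> 0"
      and sol: "\<And>b'. b' \<in> B \<Longrightarrow> (\<Sum>a\<in>?A. (M b' a - M b' a0 * M b a / M b a0) * c a) = 0"
      using insert.IH [of ?A "\<lambda>b' a. M b' a - M b' a0 * M b a / M b a0"] insert.prems by auto
    \<comment> \<open>The equation \<open>b\<close>, solved for the unknown \<open>a0\<close>.\<close>
    define c0 where "c0 = - (\<Sum>a\<in>?A. M b a * c a) / M b a0"
    have split: "(\<Sum>a\<in>A. M b' a * (c(a0 := c0)) a) = M b' a0 * c0 + (\<Sum>a\<in>?A. M b' a * c a)" for b'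
      using insert.prems a0 by (simp add: sum.remove)
    have "(\<Sum>a\<in>A. M b' a * (c(a0 := c0)) a) = 0" if "b' \<in> B" for b'
    proof -
      have "(\<Sum>a\<in>?A. M b' a * c a) - M b' a0 / M b a0 * (\<Sum>a\<in>?A. M b a * c a) = 0"
        using sol [OF that] by (simp add: algebra_simps sum_subtractf sum_distrib_left)
      then show ?thesis
        unfolding split by (simp add: c0_def)
    qed
    moreover have "(\<Sum>a\<in>A. M b a * (c(a0 := c0)) a) = 0"
      unfolding split using a0 by (simp add: c0_def)
    ultimately show ?thesis
      using c by (intro exI [of _ "c(a0 := c0)"]) auto
  qed
qed

text \<open>The list \<open>fs\<close> witnesses the strictness of a chain of primes starting at \<open>P\<close>: its members enter the chain
  one prime after another.\<close>

primrec prime_steps :: "'a::comm_ring_1 set \<Rightarrow> 'a list \<Rightarrow> bool" where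
  "prime_steps P [] \<longleftrightarrow> prime_ideal P"
| "prime_steps P (f # fs) \<longleftrightarrow> prime_ideal P \<and> f \<notin> P \<and> (\<exists>Q. P \<subseteq> Q \<and> f \<in> Q \<and> prime_steps Q fs)"

definition power_product :: "'a::comm_ring_1 list \<Rightarrow> nat list \<Rightarrow> 'a" where
  "power_product fs e = prod_list (map2 (^) fs e)"

abbreviation const :: "'k::field \<Rightarrow> ('v::finite, 'k) mpoly" where
  "const \<equiv> Poly_Mapping.single 0"

text \<open>Suppose a polynomial relation among \<open>f # fs\<close> holds modulo \<open>P\<close>. Divide it by the greatest power of \<open>f\<close>
  dividing all its terms, which is allowed as \<open>f \<notin> P\<close> and \<open>P\<close> is prime. Modulo the next prime \<open>Q\<close> the
  terms still containing \<open>f\<close> vanish, and a non-trivial relation among \<open>fs\<close> modulo \<open>Q\<close> remains.\<close>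

lemma prime_steps_algebraically_independent:
  fixes fs :: "('v::finite, 'k::field) mpoly list"
  assumes "prime_steps P fs" "finite E" "\<And>e. e \<in> E \<Longrightarrow> length e = length fs"
    and "(\<Sum>e\<in>E. const (c e) * power_product fs e) \<in> P" "e \<in> E"
  shows "c e = 0"
  using assms
proof (induction fs arbitrary: P E c e)
  case Nil
  then interpret prime_ideal P by simp
  have E: "E = {[]}" and e: "e = []"
    using Nil.prems by auto
  have "const (c []) \<in> P"
    using Nil.prems(4) by (simp add: E power_product_def)
  then have "const (1 / c []) * const (c []) \<in> P"
    by (rule mult)
  then show ?case
    using one by (cases "c [] = 0") (simp_all add: e mult_single)
next
  case (Cons f fs)
  from Cons.prems(1) obtain Q where f: "f \<notin> P" "f \<in> Q" and PQ: "P \<subseteq> Q" and Q: "prime_steps Q fs"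
    and P: "prime_ideal P"
    by auto
  interpret P: prime_ideal P by (fact P)
  interpret Q: prime_ideal Q using Q by (cases fs) auto
  show ?case
  proof (rule ccontr)
    assume ce: "c e \<noteq> 0"
    \<comment> \<open>\<open>E1\<close> collects the terms of the relation in which \<open>f\<close> has its lowest power \<open>a\<close>.\<close>
    define E' where "E' = {e \<in> E. c e \<noteq> 0}"
    define a where "a = Min (hd ` E')"
    define E1 where "E1 = {e \<in> E'. hd e = a}"
    define g where "g e = const (c e) * (f ^ (hd e - a) * power_product fs (tl e))" for e
    have E': "finite E'" "E' \<noteq> {}"
      using Cons.prems(2,5) ce by (auto simp: E'_def)
    have len: "length e = Suc (length fs)" if "e \<in> E'" for e
      using Cons.prems(3) [of e] that by (simp add: E'_def)
    have a_le: "a \<le> hd e" if "e \<in> E'" for e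
      using that E' by (simp add: a_def)
    have pp: "power_product (f # fs) e = f ^ hd e * power_product fs (tl e)" if "e \<in> E'" for e
      using len [OF that] by (cases e) (simp_all add: power_product_def)
    have "(\<Sum>e\<in>E. const (c e) * power_product (f # fs) e) = (\<Sum>e\<in>E'. const (c e) * power_product (f # fs) e)"
      using Cons.prems(2) by (intro sum.mono_neutral_right) (auto simp: E'_def)
    also have "\<dots> = (\<Sum>e\<in>E'. f ^ a * g e)"
    proof (intro sum.cong refl)
      fix e assume e: "e \<in> E'"
      have "f ^ hd e = f ^ a * f ^ (hd e - a)"
        using a_le [OF e] by (simp flip: power_add)
      then show "const (c e) * power_product (f # fs) e = f ^ a * g e"
        using pp [OF e] by (simp add: g_def algebra_simps)
    qed
    also have "\<dots> = f ^ a * (\<Sum>e\<in>E'. g e)"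
      by (simp add: sum_distrib_left)
    finally have "f ^ a * (\<Sum>e\<in>E'. g e) \<in> P"
      using Cons.prems(4) by simp
    then have "(\<Sum>e\<in>E'. g e) \<in> Q"
      using P.prime P.power f(1) PQ by blast
    moreover have "(\<Sum>e\<in>E' - E1. g e) \<in> Q"
    proof (rule Q.sum)
      fix e assume e: "e \<in> E' - E1"
      then have "a < hd e"
        using a_le [of e] by (auto simp: E1_def order.strict_iff_order)
      then have "f ^ (hd e - a) = f * f ^ (hd e - a - 1)"
        by (subst power_eq_if) simp
      then have "g e = const (c e) * f ^ (hd e - a - 1) * power_product fs (tl e) * f"
        by (simp add: g_def algebra_simps)
      then show "g e \<in> Q"
        using Q.mult [OF f(2)] by simp
    qed
    moreover have "(\<Sum>e\<in>E'. g e) - (\<Sum>e\<in>E' - E1. g e) = (\<Sum>e\<in>E1. g e)"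
      using E' by (subst sum_diff) (auto simp: E1_def)
    ultimately have "(\<Sum>e\<in>E1. g e) \<in> Q"
      using Q.diff by metis
    have cons: "a # tl e = e" if "e \<in> E1" for e
      using len [of e] that by (cases e) (auto simp: E1_def)
    then have "inj_on tl E1"
      by (metis inj_onI)
    then have "(\<Sum>e\<in>tl ` E1. const (c (a # e)) * power_product fs e) = (\<Sum>e\<in>E1. g e)"
      by (simp add: sum.reindex g_def cons) (simp add: E1_def)
    then have "(\<Sum>e\<in>tl ` E1. const (c (a # e)) * power_product fs e) \<in> Q"
      using \<open>(\<Sum>e\<in>E1. g e) \<in> Q\<close> by simp
    moreover have "a \<in> hd ` E'"
      unfolding a_def using E' by (intro Min_in) auto
    then obtain e1 where "e1 \<in> E1"
      by (auto simp: E1_def)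
    moreover have "finite (tl ` E1)"
      using E' by (simp add: E1_def)
    moreover have "length e = length fs" if "e \<in> tl ` E1" for e
      using that len by (auto simp: E1_def)
    ultimately have "c (a # tl e1) = 0"
      using Cons.IH [OF Q, of "tl ` E1" "\<lambda>e. c (a # e)" "tl e1"] by blast
    then show False
      using \<open>e1 \<in> E1\<close> cons by (auto simp: E1_def E'_def)
  qed
qed

lemma keys_mult_exponents:
  assumes "Poly_Mapping.keys f \<subseteq> exponents W {} a" "Poly_Mapping.keys g \<subseteq> exponents W {} b"
  shows "Poly_Mapping.keys (f * g) \<subseteq> exponents W {} (a + b)"
  using assms keys_mult [of f g] by (fastforce simp: exponents_def keys_add_nat total_degree_add)

lemma keys_power_exponents:
  assumes "Poly_Mapping.keys f \<subseteq> exponents W {} a"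
  shows "Poly_Mapping.keys (f ^ n) \<subseteq> exponents W {} (n * a)"
proof (induction n)
  case 0
  then show ?case by (simp add: exponents_def total_degree_def)
next
  case (Suc n)
  then show ?case
    using keys_mult_exponents [OF assms Suc] by simp
qed

lemma keys_power_product_exponents:
  assumes "\<And>f. f \<in> set fs \<Longrightarrow> Poly_Mapping.keys f \<subseteq> exponents W {} a"
    and "length e = length fs" "\<And>n. n \<in> set e \<Longrightarrow> n \<le> N"
  shows "Poly_Mapping.keys (power_product fs e) \<subseteq> exponents W {} (length fs * N * a)"
  using assms(2,1,3)
proof (induction e fs rule: list_induct2)
  case Nil
  then show ?case by (simp add: power_product_def exponents_def total_degree_def)
next
  case (Cons n e f fs)
  have "n * a \<le> N * a"
    using Cons.prems by simp
  have "Poly_Mapping.keys (f ^ n) \<subseteq> exponents W {} (n * a)"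
    using Cons.prems by (intro keys_power_exponents) simp
  also have "\<dots> \<subseteq> exponents W {} (N * a)"
    using \<open>n * a \<le> N * a\<close> unfolding exponents_def by (blast intro: order_trans)
  finally have "Poly_Mapping.keys (f ^ n * power_product fs e) \<subseteq> exponents W {} (N * a + length fs * N * a)"
    using Cons by (intro keys_mult_exponents) auto
  then show ?case
    by (simp add: power_product_def algebra_simps)
qed

lemma binomial_le_power: "(K + w) choose w \<le> (K + 1) ^ w"
proof (induction w)
  case (Suc w)
  have "Suc w * ((K + Suc w) choose Suc w) = Suc (K + w) * ((K + w) choose w)"
    using Suc_times_binomial_eq [of "K + w" w] by (simp add: mult.commute)
  also have "\<dots> \<le> (Suc w * (K + 1)) * (K + 1) ^ w"
    using Suc by (intro mult_mono) auto
  finally show ?case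
    by (simp only: mult.assoc mult_le_cancel1) simp
qed simp

lemma lookup_const_mult: "Poly_Mapping.lookup (const c * f) k = c * Poly_Mapping.lookup f k"
  by (simp flip: mult_map_scale_conv_mult add: Poly_Mapping.map.rep_eq when_def)

text \<open>With exponents below \<open>N\<close> there are \<open>N ^ length fs\<close> power products of \<open>fs\<close>, while their terms range over
  \<open>O(N ^ card W)\<close> monomials. If \<open>length fs\<close> exceeded \<open>card W\<close>, then for large \<open>N\<close> the power products would be
  linearly dependent, against algebraic independence.\<close>

lemma length_prime_steps_le:
  fixes fs :: "('v::finite, 'k::field) mpoly list"
  assumes steps: "prime_steps P fs"
    and supp: "\<And>f e. f \<in> set fs \<Longrightarrow> e \<in> Poly_Mapping.keys f \<Longrightarrow> Poly_Mapping.keys e \<subseteq> W"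
  shows "length fs \<le> card W"
proof (rule ccontr)
  assume "\<not> ?thesis"
  then have less: "Suc (card W) \<le> length fs"
    by simp
  have "\<exists>a. \<forall>f\<in>set fs. \<forall>e\<in>Poly_Mapping.keys f. total_degree e \<le> a"
  proof -
    have "finite (total_degree ` (\<Union>f\<in>set fs. Poly_Mapping.keys f))"
      by simp
    then show ?thesis
      by (auto simp: finite_nat_set_iff_bounded_le)
  qed
  then obtain a where "\<And>f e. f \<in> set fs \<Longrightarrow> e \<in> Poly_Mapping.keys f \<Longrightarrow> total_degree e \<le> a"
    by blast
  with supp have keys: "Poly_Mapping.keys f \<subseteq> exponents W {} a" if "f \<in> set fs" for f
    using that by (auto simp: exponents_def)
  \<comment> \<open>The power products have degree at most \<open>length fs * N * a\<close>, which is less than \<open>s * N\<close>. Choosing \<open>N > s ^ card W\<close> makes \<open>(s * N) ^ card W < N ^ Suc (card W)\<close>.\<close>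
  define s where "s = length fs * a + 1"
  define N where "N = s ^ card W + 1"
  define E where "E = {e. set e \<subseteq> {..<N} \<and> length e = length fs}"
  define M where "M = exponents W {} (length fs * N * a)"
  have "card M \<le> (length fs * N * a + 1) ^ card W"
    using binomial_le_power [of "length fs * N * a" "card W"] by (simp add: M_def card_exponents)
  also have "\<dots> \<le> (s * N) ^ card W"
    by (intro power_mono) (simp_all add: s_def N_def algebra_simps)
  also have "\<dots> < N ^ Suc (card W)"
    by (simp add: power_mult_distrib) (simp add: N_def)
  also have "\<dots> \<le> N ^ length fs"
    using less by (intro power_increasing) (auto simp: N_def)
  also have "\<dots> = card E"
    unfolding E_def by (simp add: card_lists_length_eq)
  finally have "card M < card E" .
  moreover have fin: "finite M" "finite E"
    unfolding M_def E_def by (simp_all add: finite_exponents finite_lists_length_eq)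
  ultimately obtain c where c: "\<exists>e\<in>E. c e \<noteq> 0"
    and sol: "\<And>x. x \<in> M \<Longrightarrow> (\<Sum>e\<in>E. Poly_Mapping.lookup (power_product fs e) x * c e) = 0"
    using homogeneous_system_nontrivial_solution [of M E "\<lambda>x e. Poly_Mapping.lookup (power_product fs e) x"]
    by blast
  have "(\<Sum>e\<in>E. const (c e) * power_product fs e) = 0"
  proof (rule poly_mapping_eqI)
    fix x
    have "(\<Sum>e\<in>E. c e * Poly_Mapping.lookup (power_product fs e) x) = 0"
    proof (cases "x \<in> M")
      case True
      then show ?thesis
        using sol [of x] by (simp add: mult.commute)
    next
      case False
      have "Poly_Mapping.lookup (power_product fs e) x = 0" if "e \<in> E" for e
      proof -
        have "Poly_Mapping.keys (power_product fs e) \<subseteq> M"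
          unfolding M_def using that keys
          by (intro keys_power_product_exponents) (auto simp: E_def)
        then show ?thesis
          using False by (auto simp: in_keys_iff)
      qed
      then show ?thesis
        by (intro sum.neutral) simp
    qed
    then show "Poly_Mapping.lookup (\<Sum>e\<in>E. const (c e) * power_product fs e) x = Poly_Mapping.lookup 0 x"
      by (simp add: lookup_sum lookup_const_mult)
  qed
  moreover have "0 \<in> P"
    using steps by (cases fs) (auto intro: prime_ideal.zero)
  ultimately show False
    using prime_steps_algebraically_independent [OF steps fin(2), of c] c
    by (auto simp: E_def)
qed

section \<open>Krull dimension of quotients by monomial ideals\<close>

abbreviation indet :: "'v::finite \<Rightarrow> ('v, 'k::field) mpoly" where
  "indet v \<equiv> Poly_Mapping.single (Poly_Mapping.single v 1) 1"

lemma single_eq_var_mult: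
  assumes "v \<in> Poly_Mapping.keys e"
  obtains e' where "e = Poly_Mapping.single v 1 + e'" "Poly_Mapping.single e c = indet v * Poly_Mapping.single e' (c :: 'k::field)"
  using exponent_split [OF assms] by (metis mult_single mult_1)

lemma mpoly_sum_terms: "f = (\<Sum>e\<in>Poly_Mapping.keys f. Poly_Mapping.single e (Poly_Mapping.lookup f e))"
  by (rule poly_mapping_eqI) (auto simp: lookup_sum lookup_single when_def in_keys_iff)

lemma prime_ideal_contains_var:
  assumes "prime_ideal P" "Poly_Mapping.single e (1 :: 'k::field) \<in> P"
  shows "\<exists>v\<in>Poly_Mapping.keys e. indet v \<in> (P :: ('v::finite, 'k) mpoly set)"
  using assms(2)
proof (induction "total_degree e" arbitrary: e)
  case 0
  then have "e = 0"
    using total_degree_0_iff by metis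
  then show ?case
    using 0 prime_ideal.one [OF assms(1)] by simp
next
  case (Suc n)
  then have "e \<noteq> 0"
    by (auto simp: total_degree_def)
  then obtain v where v: "v \<in> Poly_Mapping.keys e"
    by (metis keys_eq_empty ex_in_conv)
  obtain e' where e': "e = Poly_Mapping.single v 1 + e'"
    "Poly_Mapping.single e (1 :: 'k) = indet v * Poly_Mapping.single e' 1"
    by (rule single_eq_var_mult [OF v])
  then have "indet v \<in> P \<or> Poly_Mapping.single e' 1 \<in> P"
    using Suc.prems prime_ideal.prime [OF assms(1)] by metis
  moreover have "n = total_degree e'"
    using Suc.hyps(2) e'(1) by (simp add: total_degree_add total_degree_single)
  ultimately show ?case
    using Suc.hyps(1) v e'(1) by (auto simp: keys_add_nat)
qed

text \<open>Drop all terms that involve a variable from \<open>P\<close>.\<close>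

lemma exists_truncation_mod_prime:
  fixes f :: "('v::finite, 'k::field) mpoly"
  assumes "prime_ideal P"
  obtains g where "f - g \<in> P" "\<And>e. e \<in> Poly_Mapping.keys g \<Longrightarrow> Poly_Mapping.keys e \<subseteq> {v. indet v \<notin> P}"
proof
  interpret prime_ideal P by (fact assms)
  let ?W = "{v. indet v \<notin> P}"
  let ?S = "{e \<in> Poly_Mapping.keys f. Poly_Mapping.keys e \<subseteq> ?W}"
  let ?t = "\<lambda>e. Poly_Mapping.single e (Poly_Mapping.lookup f e)"
  have "f - (\<Sum>e\<in>?S. ?t e) = (\<Sum>e\<in>Poly_Mapping.keys f - ?S. ?t e)"
    by (subst mpoly_sum_terms, subst sum_diff) auto
  also have "\<dots> \<in> P"
  proof (rule sum)
    fix e assume "e \<in> Poly_Mapping.keys f - ?S"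
    then obtain v where v: "v \<in> Poly_Mapping.keys e" "indet v \<in> P"
      by auto
    obtain e' where "?t e = indet v * Poly_Mapping.single e' (Poly_Mapping.lookup f e)"
      by (rule single_eq_var_mult [OF v(1)])
    then show "?t e \<in> P"
      using mult_right [OF v(2)] by simp
  qed
  finally show "f - (\<Sum>e\<in>?S. ?t e) \<in> P" .
  show "Poly_Mapping.keys e \<subseteq> ?W" if "e \<in> Poly_Mapping.keys (\<Sum>e\<in>?S. ?t e)" for e
  proof -
    have "\<exists>e'\<in>?S. Poly_Mapping.lookup (?t e') e \<noteq> 0"
      using that by (metis (mono_tags, lifting) in_keys_iff lookup_sum sum.neutral)
    then show ?thesis
      by (auto simp: lookup_single when_def split: if_splits)
  qed
qed

text \<open>Witnesses of strictness survive a change modulo \<open>P\<close>, because \<open>P\<close> lies in every prime of the chain. So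
  they can be chosen with only the variables outside \<open>P\<close>.\<close>

lemma prime_chain_imp_prime_steps:
  fixes C :: "nat \<Rightarrow> ('v::finite, 'k::field) mpoly set"
  assumes "\<And>i. i \<le> l \<Longrightarrow> prime_ideal (C i)" "\<And>i. i < l \<Longrightarrow> C i \<subset> C (Suc i)"
    and "prime_ideal P" "P \<subseteq> C 0"
  shows "\<exists>fs. length fs = l \<and> prime_steps (C 0) fs \<and>
    (\<forall>f\<in>set fs. \<forall>e\<in>Poly_Mapping.keys f. Poly_Mapping.keys e \<subseteq> {v. indet v \<notin> P})"
  using assms
proof (induction l arbitrary: C)
  case 0
  then show ?case by simp
next
  case (Suc l)
  have sub: "C 0 \<subset> C 1"
    using Suc.prems(2) [of 0] by simp
  have "\<exists>fs. length fs = l \<and> prime_steps (C (Suc 0)) fs \<and>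
      (\<forall>f\<in>set fs. \<forall>e\<in>Poly_Mapping.keys f. Poly_Mapping.keys e \<subseteq> {v. indet v \<notin> P})"
    using Suc.prems sub by (intro Suc.IH [of "\<lambda>i. C (Suc i)"]) auto
  then obtain fs where fs: "length fs = l" "prime_steps (C 1) fs"
    "\<forall>f\<in>set fs. \<forall>e\<in>Poly_Mapping.keys f. Poly_Mapping.keys e \<subseteq> {v. indet v \<notin> P}"
    by auto
  obtain f where f: "f \<in> C 1" "f \<notin> C 0"
    using sub by blast
  obtain g where g: "f - g \<in> P" "\<And>e. e \<in> Poly_Mapping.keys g \<Longrightarrow> Poly_Mapping.keys e \<subseteq> {v. indet v \<notin> P}"
    using exists_truncation_mod_prime [OF Suc.prems(3)] by blast
  interpret C0: prime_ideal "C 0" using Suc.prems(1) by simp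
  interpret C1: prime_ideal "C 1" using Suc.prems(1) by simp
  have "g \<in> C 1"
    using C1.diff [of f "f - g"] f(1) g(1) sub Suc.prems(4) by auto
  moreover have "g \<notin> C 0"
    using C0.add [of "f - g" g] f(2) g(1) Suc.prems(4) by auto
  ultimately have "prime_steps (C 0) (g # fs)"
    using fs(2) sub C0.prime_ideal_axioms by auto
  then show ?case
    using fs g(2) by (intro exI [of _ "g # fs"]) auto
qed

lemma single_one_in_nonconst_monomials_iff:
  "Poly_Mapping.single e 1 \<in> (nonconst_monomials D :: ('v::finite, 'k::field) mpoly set) \<longleftrightarrow>
    0 < total_degree e \<and> total_degree e \<le> D"
  unfolding nonconst_monomials_def by (auto simp: inj_eq [OF inj_monomial])

text \<open>For a set \<open>B\<close> of monomials this says that the ideal generated by \<open>B\<close> meets \<open>k[W]\<close> only in 0.\<close>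

definition independent_vars :: "('v::finite, 'k::field) mpoly set \<Rightarrow> 'v set \<Rightarrow> bool" where
  "independent_vars B W \<longleftrightarrow> (\<forall>e. Poly_Mapping.single e 1 \<in> B \<longrightarrow> \<not> Poly_Mapping.keys e \<subseteq> W)"

text \<open>The variables outside \<open>C 0\<close> are independent because \<open>C 0\<close> is prime, and there are at least \<open>l\<close> of them
  because witnesses of strictness are algebraically independent.\<close>

lemma prime_chain_over_monomials_le:
  fixes B :: "('v::finite, 'k::field) mpoly set"
  assumes "prime_chain polynomial_ring l C" "B \<subseteq> C 0"
  shows "\<exists>W. independent_vars B W \<and> l \<le> card W"
proof (intro exI conjI)
  let ?W = "{v. indet v \<notin> C 0}"
  have C: "\<And>i. i \<le> l \<Longrightarrow> prime_ideal (C i)" "\<And>i. i < l \<Longrightarrow> C i \<subset> C (Suc i)"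
    using assms(1) by (auto simp: prime_chain_def primeideal_type_algebra_iff)
  then have C0: "prime_ideal (C 0)"
    by simp
  show "independent_vars B ?W"
    unfolding independent_vars_def using prime_ideal_contains_var [OF C0] assms(2) by blast
  obtain fs where "length fs = l" "prime_steps (C 0) fs"
    "\<forall>f\<in>set fs. \<forall>e\<in>Poly_Mapping.keys f. Poly_Mapping.keys e \<subseteq> ?W"
    using prime_chain_imp_prime_steps [of l C "C 0"] C C0 by blast
  then show "l \<le> card ?W"
    using length_prime_steps_le by blast
qed

lemma coordinate_ideal_strict_antimono:
  assumes "W \<subset> W'"
  shows "(coordinate_ideal W' :: ('v::finite, 'k::field) mpoly set) \<subset> coordinate_ideal W"
proof -
  obtain v where "v \<in> W'" "v \<notin> W"
    using assms by blast
  then have "indet v \<in> coordinate_ideal W" "indet v \<notin> (coordinate_ideal W' :: ('v, 'k) mpoly set)"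
    by (simp_all add: coordinate_ideal_def)
  moreover have "coordinate_ideal W' \<subseteq> (coordinate_ideal W :: ('v, 'k) mpoly set)"
    using assms by (auto simp: coordinate_ideal_def)
  ultimately show ?thesis
    by blast
qed

text \<open>Removing the variables from \<open>W\<close> one at a time enlarges the coordinate ideal at each step.\<close>

lemma exists_prime_chain_of_independent_vars:
  fixes B :: "('v::finite, 'k::field) mpoly set"
  assumes "B \<subseteq> nonconst_monomials D" "independent_vars B W"
  shows "\<exists>C. prime_chain polynomial_ring (card W) C \<and> (\<forall>i\<le>card W. B \<subseteq> C i)"
proof -
  obtain ws where ws: "set ws = W" "distinct ws"
    using finite_distinct_list [of W] by auto
  define C where "C i = (coordinate_ideal (set (drop i ws)) :: ('v, 'k) mpoly set)" for i
  have "C i \<subset> C (Suc i)" if "i < card W" for i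
    unfolding C_def
  proof (rule coordinate_ideal_strict_antimono)
    have "drop i ws = ws ! i # drop (Suc i) ws"
      using that ws by (metis Cons_nth_drop_Suc distinct_card)
    moreover have "distinct (drop i ws)"
      using ws by simp
    ultimately show "set (drop (Suc i) ws) \<subset> set (drop i ws)"
      by auto
  qed
  moreover have "prime_ideal (C i)" for i
    unfolding C_def by (rule prime_coordinate_ideal)
  moreover have "B \<subseteq> C i" for i
  proof
    fix f assume f: "f \<in> B"
    then obtain e where e: "f = Poly_Mapping.single e 1"
      using assms(1) by (auto simp: nonconst_monomials_def)
    then have "\<not> Poly_Mapping.keys e \<subseteq> set (drop i ws)"
      using assms(2) f ws set_drop_subset [of i ws] by (auto simp: independent_vars_def)
    then show "f \<in> C i"
      by (simp add: C_def coordinate_ideal_def e)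
  qed
  ultimately show ?thesis
    by (intro exI [of _ C]) (simp add: prime_chain_def primeideal_type_algebra_iff)
qed

theorem krull_dim_monomial_quotient:
  fixes B :: "('v::finite, 'k::field) mpoly set"
  assumes B: "B \<subseteq> nonconst_monomials D"
  shows "krull_dim (polynomial_ring Quot (Idl\<^bsub>polynomial_ring\<^esub> B)) =
    ereal (real (Max (card ` {W. independent_vars B W})))"
proof -
  let ?R = "polynomial_ring :: ('v, 'k) mpoly ring"
  let ?I = "Idl\<^bsub>?R\<^esub> B"
  interpret R: cring ?R
    by (rule cring_from_type_algebra)
  have I: "ideal ?I ?R"
    by (rule R.genideal_ideal) simp
  have I_le: "?I \<subseteq> P \<longleftrightarrow> B \<subseteq> P" if "primeideal P ?R" for P
    using R.genideal_self [of B] R.genideal_minimal [of P B] that primeideal.axioms(1) by auto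
  let ?L = "{l. \<exists>C. prime_chain (?R Quot ?I) l C}"
  let ?M = "card ` {W. independent_vars B W}"
  have L: "l \<in> ?L \<longleftrightarrow> (\<exists>C. prime_chain ?R l C \<and> (\<forall>i\<le>l. B \<subseteq> C i))" for l
    unfolding mem_Collect_eq prime_chain_quot_iff [OF R.is_cring I]
    using I_le by (metis prime_chain_def)
  have fin: "finite ?M"
    by simp
  have "independent_vars B {}"
    unfolding independent_vars_def
  proof (intro allI impI notI)
    fix e assume "Poly_Mapping.single e 1 \<in> B" "Poly_Mapping.keys e \<subseteq> {}"
    then have "e = 0" "total_degree e > 0"
      using B single_one_in_nonconst_monomials_iff [of e D] by (simp, blast)
    then show False
      by (simp add: total_degree_def)
  qed
  then have "?M \<noteq> {}"
    by auto
  then have "Max ?M \<in> ?M"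
    using fin Max_in by blast
  then have "Max ?M \<in> ?L"
    using exists_prime_chain_of_independent_vars [OF B] unfolding L by auto
  moreover have "l \<le> Max ?M" if l: "l \<in> ?L" for l
  proof -
    obtain W where W: "independent_vars B W" "l \<le> card W"
      using prime_chain_over_monomials_le l unfolding L by blast
    have "card W \<le> Max ?M"
      by (rule Max_ge [OF fin]) (use W in simp)
    with W(2) show ?thesis
      by (rule order_trans)
  qed
  ultimately show ?thesis
    unfolding krull_dim_def by (intro antisym SUP_least SUP_upper) auto
qed

section \<open>Distribution of the dimension\<close>

text \<open>Monomials of the polynomial ring for a given set of exponent vectors, so that the counts of exponent
  vectors apply to subsets of the random set.\<close>

definition monomials :: "('v::finite \<Rightarrow>\<^sub>0 nat) set \<Rightarrow> ('v, 'k::field) mpoly set" where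
  "monomials E = (\<lambda>e. Poly_Mapping.single e 1) ` E"

lemma single_in_monomials_iff [simp]: "Poly_Mapping.single e 1 \<in> monomials E \<longleftrightarrow> e \<in> E"
  unfolding monomials_def by (rule inj_image_mem_iff [OF inj_monomial])

lemma card_monomials: "card (monomials E :: ('v::finite, 'k::field) mpoly set) = card E"
  unfolding monomials_def by (rule card_image) (rule inj_on_subset [OF inj_monomial], simp)

lemma monomials_Int: "monomials E \<inter> monomials F = monomials (E \<inter> F)"
  unfolding monomials_def by (rule image_Int [OF inj_monomial, symmetric])

lemma monomials_mono: "E \<subseteq> F \<Longrightarrow> monomials E \<subseteq> monomials F"
  by (auto simp: monomials_def)

lemma monomials_empty [simp]: "monomials {} = {}"
  by (simp add: monomials_def)

lemma monomials_UN: "monomials (\<Union>i\<in>I. E i) = (\<Union>i\<in>I. monomials (E i))"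
  by (auto simp: monomials_def)

lemma nonconst_monomials_eq: "nonconst_monomials D = monomials (exponents UNIV {} D - {0})"
proof -
  have "0 < total_degree e \<longleftrightarrow> e \<noteq> 0" for e :: "'a \<Rightarrow>\<^sub>0 nat"
    using total_degree_0_iff [of e] by (metis neq0_conv)
  then show ?thesis
    by (auto simp: nonconst_monomials_def monomials_def exponents_def)
qed

lemma card_nonconst_monomials:
  "card (nonconst_monomials D :: ('v::finite, 'k::field) mpoly set) =
    ((CARD('v) + D) choose CARD('v)) - 1"
proof -
  have "0 \<in> exponents (UNIV :: 'v set) {} D"
    by (simp add: exponents_def total_degree_def)
  then show ?thesis
    unfolding nonconst_monomials_eq card_monomials
    by (simp add: finite_exponents card_exponents add.commute)
qed

definition full_support_monomials :: "nat \<Rightarrow> 'v::finite set \<Rightarrow> ('v, 'k::field) mpoly set" where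
  "full_support_monomials D U = monomials (exponents U U D)"

lemma card_full_support_monomials: "card (full_support_monomials D U) = D choose card U"
  by (simp add: full_support_monomials_def card_monomials card_exponents)

lemma full_support_monomials_subset:
  "U \<noteq> {} \<Longrightarrow> full_support_monomials D U \<subseteq> nonconst_monomials D"
  unfolding full_support_monomials_def nonconst_monomials_eq
  by (rule monomials_mono) (auto simp: exponents_def)

lemma full_support_monomials_disjoint:
  "U \<noteq> Y \<Longrightarrow> full_support_monomials D U \<inter> full_support_monomials D Y = {}"
proof -
  assume "U \<noteq> Y"
  then have "exponents U U D \<inter> exponents Y Y D = {}"
    by (auto simp: exponents_def)
  then show ?thesis
    by (simp add: full_support_monomials_def monomials_Int)
qed

lemma independent_vars_iff_avoids:
  fixes B :: "('v::finite, 'k::field) mpoly set"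
  assumes "B \<subseteq> nonconst_monomials D"
  shows "independent_vars B W \<longleftrightarrow> B \<inter> monomials (exponents W {} D - {0}) = {}"
proof -
  have "e \<in> exponents W {} D - {0}" if "Poly_Mapping.single e 1 \<in> B" "Poly_Mapping.keys e \<subseteq> W" for e
  proof -
    have "Poly_Mapping.single e 1 \<in> (monomials (exponents UNIV {} D - {0}) :: ('v, 'k) mpoly set)"
      using subsetD [OF assms that(1)] unfolding nonconst_monomials_eq .
    then have "e \<in> exponents UNIV {} D - {0}"
      by (simp only: single_in_monomials_iff)
    then show ?thesis
      using that(2) by (simp add: exponents_def)
  qed
  then have "B \<inter> monomials (exponents W {} D - {0}) \<noteq> {}" if "\<not> independent_vars B W"
    using that unfolding independent_vars_def by (metis disjoint_iff single_in_monomials_iff)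
  moreover have "\<not> independent_vars B W" if "B \<inter> monomials (exponents W {} D - {0}) \<noteq> {}"
    using that unfolding independent_vars_def by (auto simp: monomials_def exponents_def)
  ultimately show ?thesis
    by blast
qed

text \<open>Sorting the monomials by their exact support splits independence of \<open>W\<close> into conditions on pairwise
  disjoint sets, to which the product formula applies.\<close>

lemma independent_vars_iff_avoids_supports:
  fixes B :: "('v::finite, 'k::field) mpoly set"
  assumes "B \<subseteq> nonconst_monomials D"
  shows "independent_vars B W \<longleftrightarrow> (\<forall>U\<subseteq>W. U \<noteq> {} \<longrightarrow> B \<inter> full_support_monomials D U = {})"
proof -
  have "e \<in> exponents W {} D - {0} \<longleftrightarrow> (\<exists>U\<in>Pow W - {{}}. e \<in> exponents U U D)" for e
    using keys_eq_empty [of e] unfolding exponents_def by blast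
  then have "exponents W {} D - {0} = (\<Union>U\<in>Pow W - {{}}. exponents U U D)"
    by blast
  then have eq: "monomials (exponents W {} D - {0}) =
      (\<Union>U\<in>Pow W - {{}}. full_support_monomials D U :: ('v, 'k) mpoly set)"
    by (simp add: monomials_UN full_support_monomials_def)
  show ?thesis
    unfolding independent_vars_iff_avoids [OF assms] eq by blast
qed

lemma independent_vars_mono: "independent_vars B W \<Longrightarrow> W' \<subseteq> W \<Longrightarrow> independent_vars B W'"
  by (auto simp: independent_vars_def)

definition max_independent :: "('v::finite, 'k::field) mpoly set \<Rightarrow> nat" where
  "max_independent B = Max (card ` {W. independent_vars B W})"

text \<open>Subsets of independent sets are independent, so sets of exactly \<open>k\<close> variables suffice.\<close>

lemma le_max_independent_iff:
  fixes B :: "('v::finite, 'k::field) mpoly set"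
  assumes "B \<subseteq> nonconst_monomials D"
  shows "k \<le> max_independent B \<longleftrightarrow> (\<exists>W. card W = k \<and> independent_vars B W)"
proof -
  have fin: "finite (card ` {W. independent_vars B W})"
    by simp
  have "independent_vars B {}"
    by (auto simp: independent_vars_iff_avoids_supports [OF assms])
  then have ne: "card ` {W. independent_vars B W} \<noteq> {}"
    by blast
  have "\<exists>W'. card W' = k \<and> independent_vars B W'" if "independent_vars B W" "k \<le> card W" for W
    using that independent_vars_mono obtain_subset_with_card_n by metis
  moreover have "k \<le> max_independent B \<longleftrightarrow> (\<exists>W. independent_vars B W \<and> k \<le> card W)"
    unfolding max_independent_def using fin ne by (simp add: Max_ge_iff)
  ultimately show ?thesis
    by blast
qed

lemma max_independent_le_card:
  fixes B :: "('v::finite, 'k::field) mpoly set"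
  assumes "B \<subseteq> nonconst_monomials D"
  shows "max_independent B \<le> CARD('v)"
proof -
  obtain W :: "'v set" where "card W = max_independent B"
    using le_max_independent_iff [OF assms, of "max_independent B"] by blast
  then show ?thesis
    using card_mono [of UNIV W] by simp
qed

abbreviation random_monomials :: "nat \<Rightarrow> real \<Rightarrow> ('v::finite, 'k::field) mpoly set pmf" where
  "random_monomials D p \<equiv> random_subset (nonconst_monomials D) p"

lemma set_random_monomials:
  "B \<in> set_pmf (random_monomials D p) \<Longrightarrow> B \<subseteq> nonconst_monomials D"
  by (auto simp: random_subset_def)

text \<open>The combinatorial description of the dimension holds for sets of monomials only, and these have full
  probability.\<close>

lemma prob_random_monomials_cong:
  assumes "\<And>B. B \<subseteq> nonconst_monomials D \<Longrightarrow> B \<in> S \<longleftrightarrow> B \<in> T"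
  shows "measure_pmf.prob (random_monomials D p) S = measure_pmf.prob (random_monomials D p) T"
proof -
  have "S \<inter> set_pmf (random_monomials D p) = T \<inter> set_pmf (random_monomials D p)"
    using assms set_random_monomials by blast
  then show ?thesis
    by (metis measure_Int_set_pmf)
qed

lemma prob_krull_dim_random_monomial_ideal:
  "measure_pmf.prob (random_monomial_ideal D p :: ('v::finite, 'k::field) mpoly set pmf)
      {I. krull_dim (polynomial_ring Quot I) = d} =
   measure_pmf.prob (random_monomials D p :: ('v, 'k) mpoly set pmf) {B. ereal (real (max_independent B)) = d}"
  unfolding random_monomial_ideal_def measure_map_pmf
  by (rule prob_random_monomials_cong) (simp add: krull_dim_monomial_quotient max_independent_def)

context
  fixes D n :: nat and p :: real and M :: "('v::finite, 'k::field) mpoly set pmf"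
  assumes n: "n = CARD('v)" and p: "0 \<le> p" "p \<le> 1" and M: "M = random_monomials D p"
begin

lemma prob_dim_0: "measure_pmf.prob M {B. max_independent B = 0} = (1 - (1 - p) ^ D) ^ n"
proof -
  let ?T = "\<lambda>v. full_support_monomials D {v} :: ('v, 'k) mpoly set"
  have "measure_pmf.prob M {B. max_independent B = 0} =
      measure_pmf.prob M {B. B \<inter> {} = {} \<and> (\<forall>v\<in>UNIV. B \<inter> ?T v \<noteq> {})}"
    unfolding M
  proof (rule prob_random_monomials_cong)
    fix B :: "('v, 'k) mpoly set" assume B: "B \<subseteq> nonconst_monomials D"
    have "max_independent B = 0 \<longleftrightarrow> \<not> 1 \<le> max_independent B"
      by auto
    also have "\<dots> \<longleftrightarrow> (\<forall>v. \<not> independent_vars B {v})"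
      unfolding le_max_independent_iff [OF B] by (auto simp: card_1_singleton_iff)
    also have "\<dots> \<longleftrightarrow> (\<forall>v. B \<inter> ?T v \<noteq> {})"
      unfolding independent_vars_iff_avoids_supports [OF B] by (auto simp: subset_singleton_iff)
    finally show "B \<in> {B. max_independent B = 0} \<longleftrightarrow> B \<in> {B. B \<inter> {} = {} \<and> (\<forall>v\<in>UNIV. B \<inter> ?T v \<noteq> {})}"
      by simp
  qed
  also have "\<dots> = (1 - p) ^ card ({} :: ('v, 'k) mpoly set) * (\<Prod>v\<in>UNIV. 1 - (1 - p) ^ card (?T v))"
    unfolding M using p
    by (intro prob_random_subset_avoids_hits_disjoint)
      (simp_all add: finite_nonconst_monomials disjoint_family_on_def
        full_support_monomials_disjoint full_support_monomials_subset)
  also have "\<dots> = (1 - (1 - p) ^ D) ^ n"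
    by (simp add: card_full_support_monomials n)
  finally show ?thesis .
qed

text \<open>Split according to the set \<open>J\<close> of variables that have a power in \<open>B\<close>. Variables outside \<open>J\<close> are the
  independent singletons, and a pair outside \<open>J\<close> fails to be independent only through a monomial with
  support exactly that pair. Pairs meeting \<open>J\<close> are dependent anyway.\<close>

lemma prob_dim_1:
  "measure_pmf.prob M {B. max_independent B = 1} =
    (\<Sum>j=0..n-1. real (n choose j) * (1 - (1 - p) ^ D) ^ j * (1 - p) ^ (D * (n - j))
                * (1 - (1 - p) ^ (D choose 2)) ^ ((n - j) choose 2))"
proof -
  let ?T = "full_support_monomials D :: 'v set \<Rightarrow> ('v, 'k) mpoly set"
  \<comment> \<open>On the event \<open>E J\<close> exactly the variables in \<open>J\<close> have a power in \<open>B\<close>, and every pair outside \<open>J\<close> is the support of a monomial in \<open>B\<close>.\<close>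
  define R where "R J = (\<Union>v\<in>-J. ?T {v})" for J :: "'v set"
  define F where "F J = (\<lambda>v. {v}) ` J \<union> {U. U \<subseteq> -J \<and> card U = 2}" for J :: "'v set"
  define E where "E J = {B. B \<inter> R J = {} \<and> (\<forall>U\<in>F J. B \<inter> ?T U \<noteq> {})}" for J
  define g where "g j = (1 - (1 - p) ^ D) ^ j * (1 - p) ^ (D * (n - j))
      * (1 - (1 - p) ^ (D choose 2)) ^ ((n - j) choose 2)" for j
  have F_ne: "{} \<notin> F J" for J
    by (auto simp: F_def)
  have hit: "B \<inter> ?T {v} \<noteq> {} \<longleftrightarrow> v \<in> J" if "B \<in> E J" for B J v
    using that by (fastforce simp: E_def R_def F_def)
  have "measure_pmf.prob M {B. max_independent B = 1} = measure_pmf.prob M (\<Union>J\<in>-{UNIV}. E J)"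
    unfolding M
  proof (rule prob_random_monomials_cong)
    fix B :: "('v, 'k) mpoly set" assume B: "B \<subseteq> nonconst_monomials D"
    have dim: "max_independent B = 1 \<longleftrightarrow> 1 \<le> max_independent B \<and> \<not> 2 \<le> max_independent B"
      by auto
    have single: "independent_vars B {v} \<longleftrightarrow> B \<inter> ?T {v} = {}" for v
      unfolding independent_vars_iff_avoids_supports [OF B] by (auto simp: subset_singleton_iff)
    have mem: "B \<in> E J" if J: "J = {v. B \<inter> ?T {v} \<noteq> {}}" and dep: "\<And>W. card W = 2 \<Longrightarrow> \<not> independent_vars B W" for J
    proof -
      have pairs: "B \<inter> ?T U \<noteq> {}" if U: "U \<subseteq> - J" "card U = 2" for U
      proof -
        obtain Y where Y: "Y \<subseteq> U" "Y \<noteq> {}" "B \<inter> ?T Y \<noteq> {}"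
          using dep [OF U(2)] unfolding independent_vars_iff_avoids_supports [OF B] by blast
        have "card Y \<noteq> 1"
          using Y U J by (auto simp: card_1_singleton_iff)
        moreover have "card Y \<noteq> 0" "card Y \<le> 2"
          using Y U card_mono [of U Y] by auto
        ultimately have "card Y = card U"
          using U by linarith
        then have "Y = U"
          using Y(1) by (simp add: card_subset_eq)
        then show ?thesis
          using Y(3) by simp
      qed
      have "B \<inter> ?T U \<noteq> {}" if "U \<in> F J" for U
      proof (cases "U \<in> (\<lambda>v. {v}) ` J")
        case True
        then show ?thesis
          using J by blast
      next
        case False
        then show ?thesis
          using that pairs by (simp add: F_def)
      qed
      moreover have "B \<inter> R J = {}"
        using J by (auto simp: R_def)
      ultimately show ?thesis
        by (simp add: E_def)
    qed
    have dim_1I: "max_independent B = 1" if BE: "B \<in> E J" and J: "J \<noteq> UNIV" for J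
    proof -
      obtain v where "v \<notin> J"
        using J by blast
      then have "independent_vars B {v}"
        using hit [OF BE] single by blast
      moreover have "\<not> independent_vars B W" if "card W = 2" for W
      proof (cases "W \<subseteq> - J")
        case True
        then have "B \<inter> ?T W \<noteq> {}" "W \<noteq> {}"
          using BE that by (auto simp: E_def F_def)
        then show ?thesis
          unfolding independent_vars_iff_avoids_supports [OF B] by blast
      next
        case False
        then obtain w where "w \<in> W" "w \<in> J"
          by blast
        then show ?thesis
          using hit [OF BE] single independent_vars_mono [of B W "{w}"] by blast
      qed
      ultimately show ?thesis
        unfolding dim le_max_independent_iff [OF B] by (metis is_singletonI is_singleton_altdef)
    qed
    have dim_1D: "{v. B \<inter> ?T {v} \<noteq> {}} \<noteq> UNIV \<and> (\<forall>W. card W = 2 \<longrightarrow> \<not> independent_vars B W)"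
      if dim_1: "max_independent B = 1"
    proof
      obtain W where W: "card W = 1" "independent_vars B W"
        using dim_1 unfolding dim le_max_independent_iff [OF B] by blast
      obtain v where "W = {v}"
        using W(1) by (rule card_1_singletonE)
      with W(2) have "independent_vars B {v}"
        by simp
      then show "{v. B \<inter> ?T {v} \<noteq> {}} \<noteq> UNIV"
        using single by blast
      show "\<forall>W. card W = 2 \<longrightarrow> \<not> independent_vars B W"
        using dim_1 unfolding dim le_max_independent_iff [OF B] by blast
    qed
    show "B \<in> {B. max_independent B = 1} \<longleftrightarrow> B \<in> (\<Union>J\<in>-{UNIV}. E J)"
    proof
      assume "B \<in> {B. max_independent B = 1}"
      then show "B \<in> (\<Union>J\<in>-{UNIV}. E J)"
        using mem [OF refl] dim_1D by auto
    next
      assume "B \<in> (\<Union>J\<in>-{UNIV}. E J)"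
      then show "B \<in> {B. max_independent B = 1}"
        using dim_1I by auto
    qed
  qed
  also have "\<dots> = (\<Sum>J\<in>-{UNIV}. measure_pmf.prob M (E J))"
  proof (rule measure_pmf.finite_measure_finite_Union)
    show "disjoint_family_on E (- {UNIV})"
      unfolding disjoint_family_on_def using hit by blast
  qed auto
  also have "\<dots> = (\<Sum>J\<in>-{UNIV :: 'v set}. g (card J))"
  proof (intro sum.cong refl)
    fix J :: "'v set"
    have "R J \<subseteq> nonconst_monomials D"
      unfolding R_def using full_support_monomials_subset by blast
    moreover have "R J \<inter> ?T U = {}" if "U \<in> F J" for U
    proof -
      have "?T {v} \<inter> ?T U = {}" if "v \<in> - J" for v
        using \<open>U \<in> F J\<close> that by (intro full_support_monomials_disjoint) (auto simp: F_def)
      then show ?thesis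
        unfolding R_def by blast
    qed
    moreover have "?T U \<subseteq> nonconst_monomials D" if "U \<in> F J" for U
      using that F_ne [of J] by (intro full_support_monomials_subset) auto
    ultimately have "measure_pmf.prob M (E J) = (1 - p) ^ card (R J) * (\<Prod>U\<in>F J. 1 - (1 - p) ^ card (?T U))"
      unfolding E_def M using p
      by (intro prob_random_subset_avoids_hits_disjoint)
        (simp_all add: finite_nonconst_monomials disjoint_family_on_def full_support_monomials_disjoint)
    also have "card (R J) = (\<Sum>v\<in>-J. card (?T {v}))"
      unfolding R_def
    proof (rule card_UN_disjoint)
      show "\<forall>v\<in>-J. finite (?T {v})"
        by (intro ballI finite_subset [OF full_support_monomials_subset finite_nonconst_monomials]) simp
    qed (simp_all add: full_support_monomials_disjoint)
    also have "\<dots> = D * (n - card J)"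
      by (simp add: card_full_support_monomials n Compl_eq_Diff_UNIV card_Diff_subset)
    also have "(\<Prod>U\<in>F J. 1 - (1 - p) ^ card (?T U)) =
        (\<Prod>v\<in>J. 1 - (1 - p) ^ D) * (\<Prod>U | U \<subseteq> -J \<and> card U = 2. 1 - (1 - p) ^ (D choose 2))"
      unfolding F_def by (subst prod.union_disjoint) (auto simp: card_full_support_monomials prod.reindex)
    also have "(\<Prod>v\<in>J. 1 - (1 - p) ^ D) = (1 - (1 - p) ^ D) ^ card J"
      by simp
    also have "(\<Prod>U | U \<subseteq> -J \<and> card U = 2. 1 - (1 - p) ^ (D choose 2)) =
        (1 - (1 - p) ^ (D choose 2)) ^ ((n - card J) choose 2)"
      by (simp add: n_subsets n Compl_eq_Diff_UNIV card_Diff_subset)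
    finally show "measure_pmf.prob M (E J) = g (card J)"
      by (simp add: g_def)
  qed
  also have "- {UNIV} = {J :: 'v set. J \<subseteq> UNIV \<and> card J \<in> {0..n-1}}"
  proof -
    have "J \<noteq> UNIV \<longleftrightarrow> card J \<le> n - 1" for J :: "'v set"
    proof -
      have "card J = n \<longleftrightarrow> J = UNIV"
        using card_subset_eq [of UNIV J] n by auto
      moreover have "card J \<le> n" "n > 0"
        using card_mono [of UNIV J] n by auto
      ultimately show ?thesis
        by linarith
    qed
    then show ?thesis
      by auto
  qed
  also have "(\<Sum>J | J \<subseteq> (UNIV :: 'v set) \<and> card J \<in> {0..n-1}. g (card J)) =
      (\<Sum>j\<in>{0..n-1} \<inter> {..card (UNIV :: 'v set)}. real (card (UNIV :: 'v set) choose j) * g j)"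
    by (rule sum_subsets_by_card) simp
  also have "{0..n-1} \<inter> {..card (UNIV :: 'v set)} = {0..n-1}"
    by (auto simp: n)
  finally show ?thesis
    by (simp add: g_def n mult.assoc)
qed

lemma prob_dim_n: "measure_pmf.prob M {B. max_independent B = n} = (1 - p) ^ (((n + D) choose n) - 1)"
proof -
  have "measure_pmf.prob M {B. max_independent B = n} =
      measure_pmf.prob M {B. B \<inter> nonconst_monomials D = {}}"
    unfolding M
  proof (rule prob_random_monomials_cong)
    fix B :: "('v, 'k) mpoly set" assume B: "B \<subseteq> nonconst_monomials D"
    have "max_independent B = n \<longleftrightarrow> n \<le> max_independent B"
      using max_independent_le_card [OF B] n by auto
    also have "\<dots> \<longleftrightarrow> independent_vars B UNIV"
      unfolding le_max_independent_iff [OF B] using card_subset_eq [of "UNIV :: 'v set"] by (auto simp: n)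
    finally show "B \<in> {B. max_independent B = n} \<longleftrightarrow> B \<in> {B. B \<inter> nonconst_monomials D = {}}"
      by (simp add: independent_vars_iff_avoids [OF B] nonconst_monomials_eq)
  qed
  also have "\<dots> = (1 - p) ^ card (nonconst_monomials D :: ('v, 'k) mpoly set)"
    unfolding M using p finite_nonconst_monomials by (intro prob_random_subset_avoids) auto
  finally show ?thesis
    by (simp add: card_nonconst_monomials n)
qed

text \<open>The set of all variables but \<open>v\<close> is independent iff \<open>v\<close> divides every monomial in \<open>B\<close>. Inclusion-exclusion
  gives the probability that this holds for some \<open>v\<close>, and the empty \<open>B\<close>, of dimension \<open>n\<close>, is subtracted.\<close>

lemma prob_dim_n_minus_1:
  "measure_pmf.prob M {B. max_independent B = n - 1} =
    - ((1 - p) ^ (((n + D) choose n) - 1))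
             + (\<Sum>j=1..n. (-1) ^ (j - 1) * real (n choose j)
                * (1 - p) ^ (((n + D) choose n) - 1 - ((n + D - j) choose n)))"
proof -
  let ?N = "\<lambda>v. monomials (exponents (- {v}) {} D - {0}) :: ('v, 'k) mpoly set"
  define h where "h j = (-1 :: real) ^ j * (1 - p) ^ (((n + D) choose n) - 1 - ((n + D - j) choose n))" for j
  have n0: "n > 0"
    by (simp add: n)
  have ge: "n - 1 \<le> max_independent B \<longleftrightarrow> \<not> (B \<inter> {} = {} \<and> (\<forall>v\<in>UNIV. B \<inter> ?N v \<noteq> {}))"
    if B: "B \<subseteq> nonconst_monomials D" for B
  proof -
    have "card W = n - 1 \<longleftrightarrow> (\<exists>v. W = - {v})" for W :: "'v set"
    proof
      assume "card W = n - 1"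
      then have "card (- W) = 1"
        using n0 by (simp add: Compl_eq_Diff_UNIV card_Diff_subset n)
      then show "\<exists>v. W = - {v}"
        by (metis card_1_singletonE double_complement)
    qed (auto simp: Compl_eq_Diff_UNIV card_Diff_subset n)
    then show ?thesis
      unfolding le_max_independent_iff [OF B] by (auto simp: independent_vars_iff_avoids [OF B])
  qed
  have N_sub: "?N v \<subseteq> nonconst_monomials D" for v
    unfolding nonconst_monomials_eq by (rule monomials_mono) (auto simp: exponents_def)
  have card_N: "card (\<Union>v\<in>K. ?N v) = ((n + D) choose n) - 1 - ((n + D - card K) choose n)"
    if "K \<noteq> {}" for K
  proof -
    have "(\<Union>v\<in>K. exponents (- {v}) {} D - {0}) = (exponents UNIV {} D - {0}) - exponents UNIV K D"
      by (auto simp: exponents_def)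
    moreover have "exponents UNIV K D \<subseteq> exponents UNIV {} D - {0}"
      using that by (auto simp: exponents_def)
    moreover have "card (exponents (UNIV :: 'v set) {} D - {0}) = ((n + D) choose n) - 1"
      using card_nonconst_monomials [where 'v = 'v and 'k = 'k, of D]
      by (simp add: nonconst_monomials_eq card_monomials n)
    ultimately have "card (\<Union>v\<in>K. exponents (- {v}) {} D - {0}) =
        ((n + D) choose n) - 1 - card (exponents UNIV K D)"
      by (simp add: card_Diff_subset finite_exponents)
    then show ?thesis
      by (simp add: card_monomials card_exponents n add.commute flip: monomials_UN)
  qed
  have "measure_pmf.prob M {B. B \<inter> {} = {} \<and> (\<forall>v\<in>UNIV. B \<inter> ?N v \<noteq> {})} =
      (\<Sum>K\<in>Pow UNIV. (-1) ^ card K * (1 - p) ^ card ({} \<union> (\<Union>v\<in>K. ?N v)))"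
    unfolding M using p N_sub finite_nonconst_monomials
    by (intro prob_random_subset_avoids_hits) auto
  also have "\<dots> = 1 + (\<Sum>K\<in>Pow UNIV - {{}}. (-1) ^ card K * (1 - p) ^ card (\<Union>v\<in>K. ?N v))"
    by (subst sum.remove [of _ "{}"]) auto
  also have "(\<Sum>K\<in>Pow UNIV - {{}}. (-1) ^ card K * (1 - p) ^ card (\<Union>v\<in>K. ?N v)) =
      (\<Sum>K\<in>Pow UNIV - {{}}. h (card (K :: 'v set)))"
    by (intro sum.cong) (simp_all add: card_N h_def)
  also have "Pow UNIV - {{}} = {K :: 'v set. K \<subseteq> UNIV \<and> card K \<in> {1..n}}"
    by (auto simp: Suc_le_eq card_gt_0_iff n card_mono)
  also have "(\<Sum>K | K \<subseteq> (UNIV :: 'v set) \<and> card K \<in> {1..n}. h (card K)) =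
      (\<Sum>j\<in>{1..n} \<inter> {..card (UNIV :: 'v set)}. real (card (UNIV :: 'v set) choose j) * h j)"
    by (rule sum_subsets_by_card) simp
  also have "{1..n} \<inter> {..card (UNIV :: 'v set)} = {1..n}"
    by (auto simp: n)
  also have "(\<Sum>j=1..n. real (card (UNIV :: 'v set) choose j) * h j) =
     - (\<Sum>j=1..n. (-1) ^ (j - 1) * real (n choose j)
                * (1 - p) ^ (((n + D) choose n) - 1 - ((n + D - j) choose n)))"
    unfolding sum_negf [symmetric]
  proof (intro sum.cong refl)
    fix j assume "j \<in> {1..n}"
    then have "(-1 :: real) ^ j = - ((-1) ^ (j - 1))"
      by (cases j) auto
    then show "real (card (UNIV :: 'v set) choose j) * h j = - ((-1) ^ (j - 1) * real (n choose j)
                * (1 - p) ^ (((n + D) choose n) - 1 - ((n + D - j) choose n)))"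
      by (simp add: h_def n)
  qed
  finally have all_hit: "measure_pmf.prob M {B. B \<inter> {} = {} \<and> (\<forall>v\<in>UNIV. B \<inter> ?N v \<noteq> {})} =
      1 - (\<Sum>j=1..n. (-1) ^ (j - 1) * real (n choose j)
                * (1 - p) ^ (((n + D) choose n) - 1 - ((n + D - j) choose n)))"
    by simp
  have "measure_pmf.prob M {B. n - 1 \<le> max_independent B} =
      measure_pmf.prob M (UNIV - {B. B \<inter> {} = {} \<and> (\<forall>v\<in>UNIV. B \<inter> ?N v \<noteq> {})})"
    unfolding M by (rule prob_random_monomials_cong) (use ge in blast)
  also have "\<dots> = 1 - measure_pmf.prob M {B. B \<inter> {} = {} \<and> (\<forall>v\<in>UNIV. B \<inter> ?N v \<noteq> {})}"
    using measure_pmf.prob_compl [of "{B. B \<inter> {} = {} \<and> (\<forall>v\<in>UNIV. B \<inter> ?N v \<noteq> {})}" M] by simp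
  also have "\<dots> = (\<Sum>j=1..n. (-1) ^ (j - 1) * real (n choose j)
                * (1 - p) ^ (((n + D) choose n) - 1 - ((n + D - j) choose n)))"
    unfolding all_hit by simp
  finally have ge_prob: "measure_pmf.prob M {B. n - 1 \<le> max_independent B} =
      (\<Sum>j=1..n. (-1) ^ (j - 1) * real (n choose j)
                * (1 - p) ^ (((n + D) choose n) - 1 - ((n + D - j) choose n)))" .
  have "measure_pmf.prob M {B. max_independent B = n - 1} =
      measure_pmf.prob M ({B. n - 1 \<le> max_independent B} - {B. max_independent B = n})"
    unfolding M
  proof (rule prob_random_monomials_cong)
    fix B :: "('v, 'k) mpoly set" assume B: "B \<subseteq> nonconst_monomials D"
    have "max_independent B \<le> n"
      using max_independent_le_card [OF B] by (simp add: n)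
    then show "B \<in> {B. max_independent B = n - 1} \<longleftrightarrow> B \<in> {B. n - 1 \<le> max_independent B} - {B. max_independent B = n}"
      using n0 by auto
  qed
  also have "\<dots> = measure_pmf.prob M {B. n - 1 \<le> max_independent B} - measure_pmf.prob M {B. max_independent B = n}"
    by (rule measure_pmf.finite_measure_Diff) auto
  finally show ?thesis
    unfolding ge_prob prob_dim_n by simp
qed

lemma sum_prob_dim: "(\<Sum>k\<le>n. measure_pmf.prob M {B. max_independent B = k}) = 1"
proof -
  have "(\<Sum>k\<le>n. measure_pmf.prob M {B. max_independent B = k}) =
      measure_pmf.prob M (\<Union>k\<in>{..n}. {B. max_independent B = k})"
    by (rule measure_pmf.finite_measure_finite_Union [symmetric]) (auto simp: disjoint_family_on_def)
  also have "\<dots> = measure_pmf.prob M UNIV"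
    unfolding M using max_independent_le_card by (intro prob_random_monomials_cong) (auto simp: n)
  finally show ?thesis
    by simp
qed

end

theorem theorem3p2:
  fixes n D :: nat and p :: real
    and \<II> :: "('v::finite, 'k::field) mpoly set pmf"
    and P :: "ereal \<Rightarrow> real"
  assumes n: "n = CARD('v)"
    and p: "0 \<le> p" "p \<le> 1"
    and \<II>: "\<II> = random_monomial_ideal D p"
    and P: "\<And>d. P d = measure_pmf.prob \<II> {I. krull_dim (polynomial_ring Quot I) = d}"
  shows
    "let a = (1 - (1 - p) ^ D) ^ n;
         b = (\<Sum>j=0..n-1. real (n choose j) * (1 - (1 - p) ^ D) ^ j * (1 - p) ^ (D * (n - j))
                * (1 - (1 - p) ^ (D choose 2)) ^ ((n - j) choose 2));
         c = - ((1 - p) ^ (((n + D) choose n) - 1))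
             + (\<Sum>j=1..n. (-1) ^ (j - 1) * real (n choose j)
                * (1 - p) ^ (((n + D) choose n) - 1 - ((n + D - j) choose n)));
         e = (1 - p) ^ (((n + D) choose n) - 1)
     in P 0 = a
      \<and> P 1 = b
      \<and> P (ereal (real (n - 1))) = c
      \<and> P (ereal (real n)) = e
      \<and> (n \<le> 4 \<longrightarrow>
          (\<forall>d. P d = (if d = 0 then a
                      else if d = 1 then b
                      else if d = ereal (real (n - 1)) then c
                      else if d = ereal (real n) then e
                      else if d \<in> (\<lambda>i. ereal (real i)) ` {0..n} then 1 - (a + b + c + e)
                      else 0)))"
proof -
  define M :: "('v, 'k) mpoly set pmf" where "M = random_monomials D p"
  have P_eq: "P d = measure_pmf.prob M {B. ereal (real (max_independent B)) = d}" for d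
    unfolding P \<II> M_def by (rule prob_krull_dim_random_monomial_ideal)
  have P_nat: "P (ereal (real k)) = measure_pmf.prob M {B. max_independent B = k}" for k
    unfolding P_eq by simp
  note dim = prob_dim_0 [OF n p M_def] prob_dim_1 [OF n p M_def]
    prob_dim_n_minus_1 [OF n p M_def] prob_dim_n [OF n p M_def]
  have P01: "P 0 = measure_pmf.prob M {B. max_independent B = 0}"
    "P 1 = measure_pmf.prob M {B. max_independent B = 1}"
    using P_nat [of 0] P_nat [of 1] by (simp_all add: zero_ereal_def one_ereal_def)
  have outside: "P d = 0" if "d \<notin> (\<lambda>i. ereal (real i)) ` {0..n}" for d
  proof -
    have "P d = measure_pmf.prob M {}"
      unfolding P_eq M_def
    proof (rule prob_random_monomials_cong)
      fix B :: "('v, 'k) mpoly set" assume "B \<subseteq> nonconst_monomials D"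
      then have "max_independent B \<in> {0..n}"
        using max_independent_le_card n by auto
      then show "B \<in> {B. ereal (real (max_independent B)) = d} \<longleftrightarrow> B \<in> {}"
        using that by blast
    qed
    then show ?thesis
      by simp
  qed
  have middle: "P d = 1 - (P 0 + P 1 + P (ereal (real (n - 1))) + P (ereal (real n)))"
    if "n \<le> 4" and d: "d \<in> (\<lambda>i. ereal (real i)) ` {0..n}"
      "d \<noteq> 0" "d \<noteq> 1" "d \<noteq> ereal (real (n - 1))" "d \<noteq> ereal (real n)" for d
  proof -
    obtain k where k: "d = ereal (real k)" "k \<le> n"
      using d(1) by auto
    with d have "k \<noteq> 0" "k \<noteq> 1" "k \<noteq> n - 1" "k \<noteq> n"
      by (auto simp: zero_ereal_def one_ereal_def)
    with k \<open>n \<le> 4\<close> have "n = 4" "k = 2"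
      by linarith+
    moreover have "{..4::nat} = {0, 1, 2, 3, 4}"
      by auto
    ultimately show ?thesis
      using sum_prob_dim [OF n p M_def] unfolding P01 k P_nat by simp
  qed
  have table: "P 0 = a \<and> P 1 = b \<and> P (ereal (real (n - 1))) = c \<and> P (ereal (real n)) = e
      \<and> (n \<le> 4 \<longrightarrow>
          (\<forall>d. P d = (if d = 0 then a
                      else if d = 1 then b
                      else if d = ereal (real (n - 1)) then c
                      else if d = ereal (real n) then e
                      else if d \<in> (\<lambda>i. ereal (real i)) ` {0..n} then 1 - (a + b + c + e)
                      else 0)))"
    if "P 0 = a" "P 1 = b" "P (ereal (real (n - 1))) = c" "P (ereal (real n)) = e" for a b c e
    using that outside middle by (auto simp del: of_nat_diff)
  show ?thesis
    unfolding Let_def by (rule table) (simp_all only: P01 P_nat dim)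
qed

end
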